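(* Let $r,d\in\mathbb{N}$ with $r,d\ge 1$, let $a<b$, $D>0$, let $M\subset\mathbb{R}^d$ be a nonempty open set and let $\eta\in M$. For the class of standard nonadaptive information, the $\varepsilon$-complexity of the non-autonomous initial-value problem $z'(t)=f(t,z(t))$, $t\in[a,b]$, $z(a)=\eta$, in the function class $F_{r,d}^{\mathrm{non}}$ satisfies $$\mathrm{comp}^{\mathrm{nonad}}(\varepsilon,F_{r,d}^{\mathrm{non}})=\Omega\left(\left(1/\varepsilon\right)^{(d+1)/r}\right)\quad\text{as }\varepsilon\to0 .$$
   Context: Throughout, $\|\cdot\|$ is the maximum norm in $\mathbb{R}^d$, and $\mathbb{N}$ denotes the positive integers. The numbers $a<b$, the vector $\eta$, the set $M$, the number $D$, and $r,d$ are fixed; the asymptotic symbol $\Omega$ is meant as $\varepsilon\to0$, i.e. $g(\varepsilon)=\Omega(\gamma(\varepsilon))$ means that there are $C>0$ and $\varepsilon_0>0$ with $g(\varepsilon)\ge C\gamma(\varepsilon)$ for all $0<\varepsilon\le\varepsilon_0$. Function class: $$F_{r,d}^{\mathrm{non}}=\{f:[a,b]\times\mathbb{R}^d\to\mathbb{R}^d:\ f\in C^r([a,b]\times\mathbb{R}^d),\ f(t,y)=0\text{ for }y\notin M,\ |D^if^j(t,y)|\le D,\ (t,y)\in[a,b]\times\mathbb{R}^d,\ i=0,1,\ldots,r,\ j=1,\ldots,d\},$$ where $D^if^j$ denotes any partial derivative of order $i$ (with respect to the $d+1$ variables $(t,y)$) of the $j$th component of $f=[f^1,\ldots,f^d]^T$.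 For $f\in F_{r,d}^{\mathrm{non}}$, $z=z_f:[a,b]\to\mathbb{R}^d$ denotes the solution of $z'(t)=f(t,z(t))$, $t\in[a,b]$, $z(a)=\eta$. Information: for $n\in\mathbb{N}$, standard nonadaptive information is a vector $N_n(f)=[L_1(f),\ldots,L_n(f)]^T$ with $L_j(f)=D^{k_j}f^{i_j}(t_j,y_j)$, where $D^{k_j}$ is some partial derivative of order $k_j$, $0\le k_j\le r$, $1\le i_j\le d$, $(t_j,y_j)\in[a,b]\times\mathbb{R}^d$, and all $k_j$, $D^{k_j}$, $i_j$, $(t_j,y_j)$ are fixed in advance, independently of $f$. Algorithm and error: an algorithm is any function $\Phi_n$ which assigns to the vector $N_n(f)\in\mathbb{R}^n$ a function $l=\Phi_n(N_n(f)):[a,b]\to\mathbb{R}^d$. Its worst-case error is $$e(\Phi_n,N_n,F_{r,d}^{\mathrm{non}})=\sup_{f\in F_{r,d}^{\mathrm{non}}}\ \sup_{t\in[a,b]}\|z_f(t)-\Phi_n(N_n(f))(t)\| .$$ Complexity: $$\mathrm{comp}^{\mathrm{nonad}}(\varepsilon,F_{r,d}^{\mathrm{non}})=\min\{n\ge1:\ \text{there exist standard nonadaptive }N_n\text{ and an algorithm }\Phi_n\text{ with }e(\Phi_n,N_n,F_{r,d}^{\mathrm{non}})\le\varepsilon\},$$ with $\min\emptyset=+\infty$. *)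

theory Defs
  imports "HOL-Analysis.Analysis"
begin

section \<open>Iterated partial derivatives and the class of r times continuously differentiable functions\<close>

text \<open>Difference quotients only use points of the set \<open>S\<close>, so derivatives are one-sided
  at the boundary, and the values of \<open>g\<close> outside \<open>S\<close> are irrelevant on \<open>S\<close>.\<close>

definition partial_derivative :: "'a::euclidean_space set \<Rightarrow> 'a \<Rightarrow> ('a \<Rightarrow> real) \<Rightarrow> 'a \<Rightarrow> real" where
  "partial_derivative S e g p =
     vector_derivative (\<lambda>s. g (p + s *\<^sub>R e)) (at 0 within {s. p + s *\<^sub>R e \<in> S})"

primrec iterated_partial ::
  "'a::euclidean_space set \<Rightarrow> 'a list \<Rightarrow> ('a \<Rightarrow> real) \<Rightarrow> 'a \<Rightarrow> real" where
  "iterated_partial S [] g = g"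
| "iterated_partial S (e # es) g = partial_derivative S e (iterated_partial S es g)"

definition Cr_on :: "nat \<Rightarrow> 'a::euclidean_space set \<Rightarrow> ('a \<Rightarrow> real) \<Rightarrow> bool" where
  "Cr_on r S g \<longleftrightarrow>
     (\<forall>es. set es \<subseteq> Basis \<and> length es \<le> r \<longrightarrow> continuous_on S (iterated_partial S es g)) \<and>
     (\<forall>es. set es \<subseteq> Basis \<and> length es < r \<longrightarrow>
        (\<forall>e\<in>Basis. \<forall>p\<in>S. (\<lambda>s. iterated_partial S es g (p + s *\<^sub>R e))
           differentiable (at 0 within {s. p + s *\<^sub>R e \<in> S})))"


section \<open>The function class and the initial-value problem\<close>

text \<open>The \<open>d + 1\<close> variables \<open>(t, y)\<close> are points of \<open>real \<times> (real ^ 'd)\<close>, whose \<open>Basis\<close> consists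
  of the \<open>d + 1\<close> coordinate directions.\<close>

abbreviation strip :: "real \<Rightarrow> real \<Rightarrow> (real \<times> (real ^ 'd)) set" where
  "strip a b \<equiv> {a..b} \<times> UNIV"

definition F_non :: "nat \<Rightarrow> real \<Rightarrow> real \<Rightarrow> (real ^ 'd) set \<Rightarrow> real \<Rightarrow>
    (real \<times> (real ^ 'd) \<Rightarrow> real ^ 'd) set" where
  "F_non r a b M D = {f.
     (\<forall>j. Cr_on r (strip a b) (\<lambda>p. f p $ j)) \<and>
     (\<forall>t\<in>{a..b}. \<forall>y. y \<notin> M \<longrightarrow> f (t, y) = 0) \<and>
     (\<forall>es j. set es \<subseteq> Basis \<and> length es \<le> r \<longrightarrow>
        (\<forall>p\<in>strip a b. \<bar>iterated_partial (strip a b) es (\<lambda>q. f q $ j) p\<bar> \<le> D))}"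

definition ivp_solves :: "real \<Rightarrow> real \<Rightarrow> real ^ 'd \<Rightarrow> (real \<times> (real ^ 'd) \<Rightarrow> real ^ 'd) \<Rightarrow>
    (real \<Rightarrow> real ^ 'd) \<Rightarrow> bool" where
  "ivp_solves a b \<eta> f z \<longleftrightarrow> z a = \<eta> \<and>
     (\<forall>t\<in>{a..b}. (z has_vector_derivative f (t, z t)) (at t within {a..b}))"

text \<open>For \<open>f \<in> F_non r a b M D\<close> with \<open>r \<ge> 1\<close> the right-hand side is globally Lipschitz in \<open>y\<close>, so a
  solution exists and is unique on \<open>{a..b}\<close>; the choice only concerns values outside \<open>{a..b}\<close>.\<close>

definition ivp_solution :: "real \<Rightarrow> real \<Rightarrow> real ^ 'd \<Rightarrow> (real \<times> (real ^ 'd) \<Rightarrow> real ^ 'd) \<Rightarrow>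
    real \<Rightarrow> real ^ 'd" where
  "ivp_solution a b \<eta> f = (SOME z. ivp_solves a b \<eta> f z)"


section \<open>Standard nonadaptive information, algorithms, error and complexity\<close>

text \<open>A triple \<open>(es, i, p)\<close> encodes evaluation at \<open>p\<close> of the partial derivative in the
  directions \<open>es\<close> of component \<open>i\<close>; a list of length \<open>n\<close> of such triples encodes \<open>N\<^sub>n\<close>.\<close>

type_synonym 'd functional = "(real \<times> (real ^ 'd)) list \<times> 'd \<times> (real \<times> (real ^ 'd))"

definition standard_functional :: "nat \<Rightarrow> real \<Rightarrow> real \<Rightarrow> 'd::finite functional \<Rightarrow> bool" where
  "standard_functional r a b = (\<lambda>(es, i, p). set es \<subseteq> Basis \<and> length es \<le> r \<and> p \<in> strip a b)"

definition eval_functional :: "real \<Rightarrow> real \<Rightarrow> (real \<times> (real ^ 'd) \<Rightarrow> real ^ 'd) \<Rightarrow>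
    'd::finite functional \<Rightarrow> real" where
  "eval_functional a b f = (\<lambda>(es, i, p). iterated_partial (strip a b) es (\<lambda>q. f q $ i) p)"

definition information :: "real \<Rightarrow> real \<Rightarrow> 'd::finite functional list \<Rightarrow>
    (real \<times> (real ^ 'd) \<Rightarrow> real ^ 'd) \<Rightarrow> real list" where
  "information a b N f = map (eval_functional a b f) N"

text \<open>\<open>infnorm\<close> is the maximum norm.\<close>

definition worst_case_error :: "nat \<Rightarrow> real \<Rightarrow> real \<Rightarrow> (real ^ 'd) set \<Rightarrow> real \<Rightarrow> real ^ 'd \<Rightarrow>
    (real list \<Rightarrow> real \<Rightarrow> real ^ 'd) \<Rightarrow> 'd::finite functional list \<Rightarrow> ereal" where
  "worst_case_error r a b M D \<eta> \<Phi> N =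
     (SUP f\<in>F_non r a b M D. SUP t\<in>{a..b}.
        ereal (infnorm (ivp_solution a b \<eta> f t - \<Phi> (information a b N f) t)))"

text \<open>On \<open>enat\<close>, \<open>Inf\<close> of a nonempty set is its minimum, and \<open>Inf {} = \<infinity>\<close>.\<close>

definition comp_nonad :: "nat \<Rightarrow> real \<Rightarrow> real \<Rightarrow> (real ^ 'd::finite) set \<Rightarrow> real \<Rightarrow> real ^ 'd \<Rightarrow>
    real \<Rightarrow> enat" where
  "comp_nonad r a b M D \<eta> \<epsilon> = Inf {enat n | n. n \<ge> 1 \<and>
     (\<exists>N \<Phi>. length N = n \<and> (\<forall>L\<in>set N. standard_functional r a b L) \<and>
        worst_case_error r a b M D \<eta> \<Phi> N \<le> ereal \<epsilon>)}"

end

theory Submission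
  imports Defs
begin

text \<open>
  Let the field drive the solution from \<open>\<eta>\<close> to \<open>\<eta> + v\<close> during the first half of \<open>[a, b]\<close> and vanish
  near the trajectory during the second half, where the solution then stays constant. Divide the second
  half of the time interval, times a small cube of possible values \<open>\<eta> + v\<close>, into \<open>N ^ (d + 1)\<close> cells. If
  at most half of the cells contain a sample point, then some column of cells \<open>(time cells) \<times> {cell of \<eta> + v}\<close>
  has at least \<open>N / 2\<close> cells without sample points. Choose \<open>v\<close> to be the centre of this column, which is
  possible because the information is nonadaptive, and put bumps of height of order \<open>N ^ (- r)\<close> on the empty
  cells. The information does not see them, but each one moves the solution by an amount of order
  \<open>N ^ (- r - 1)\<close>, in total by \<open>N ^ (- r)\<close>. Bumps that are constant near the middle of the cell make both
  solutions explicit.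
\<close>

section \<open>Smooth cut-off functions on the real line\<close>

text \<open>A function of class C^m is carried as the whole sequence of its derivatives,
  \<open>g j\<close> being the j-th one, so that sums and rescalings keep every derivative
  explicit.\<close>

definition deriv_chain :: "nat \<Rightarrow> (nat \<Rightarrow> real \<Rightarrow> real) \<Rightarrow> bool" where
  "deriv_chain m g \<longleftrightarrow>
     (\<forall>j<m. \<forall>x. (g j has_real_derivative g (Suc j) x) (at x)) \<and> (\<forall>j\<le>m. continuous_on UNIV (g j))"

lemma deriv_chainD:
  "deriv_chain m g \<Longrightarrow> j < m \<Longrightarrow> (g j has_real_derivative g (Suc j) x) (at x)"
  "deriv_chain m g \<Longrightarrow> j \<le> m \<Longrightarrow> continuous_on A (g j)"
  unfolding deriv_chain_def by (auto intro: continuous_on_subset)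

lemma deriv_chain_affine:
  assumes "deriv_chain m g"
  shows "deriv_chain m (\<lambda>j x. s ^ j * g j (s * x + c))"
  unfolding deriv_chain_def
proof (intro conjI allI impI)
  fix j x assume "j < m"
  show "((\<lambda>x. s ^ j * g j (s * x + c)) has_real_derivative s ^ Suc j * g (Suc j) (s * x + c)) (at x)"
    by (auto intro!: derivative_eq_intros DERIV_chain2[OF deriv_chainD(1)[OF assms \<open>j < m\<close>]])
next
  fix j assume "j \<le> m"
  show "continuous_on UNIV (\<lambda>x. s ^ j * g j (s * x + c))"
    by (intro continuous_intros continuous_on_compose2[OF deriv_chainD(2)[OF assms \<open>j \<le> m\<close>, of UNIV]]) auto
qed

lemma deriv_chain_Suc:
  assumes "deriv_chain (Suc m) g"
  shows "deriv_chain m (\<lambda>j. g (Suc j))"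
  using assms unfolding deriv_chain_def by auto

lemma deriv_chain_diff:
  assumes "deriv_chain m f" "deriv_chain m g"
  shows "deriv_chain m (\<lambda>j x. f j x - g j x)"
  using assms unfolding deriv_chain_def by (simp add: DERIV_diff continuous_on_diff)

lemma deriv_chain_sum:
  assumes "\<And>i. i \<in> I \<Longrightarrow> deriv_chain m (g i)"
  shows "deriv_chain m (\<lambda>j x. \<Sum>i\<in>I. g i j x)"
  using assms unfolding deriv_chain_def by (simp add: DERIV_sum continuous_on_sum)

text \<open>Averaging over unit intervals, \<open>x \<mapsto> \<integral>\<^bsub>x-1\<^esub>\<^bsup>x\<^esup> \<sigma>\<close>, gains one derivative and lengthens the ramp by 1.\<close>

lemma ex_deriv_chain_ramp:
  "\<exists>\<sigma>. deriv_chain m \<sigma> \<and> (\<forall>j\<le>m. \<forall>x\<le>0. \<sigma> j x = 0) \<and> (\<forall>x\<ge>real (Suc m). \<sigma> 0 x = 1)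
     \<and> (\<forall>j\<le>m. \<forall>x\<ge>real (Suc m). j \<noteq> 0 \<longrightarrow> \<sigma> j x = 0) \<and> (\<forall>x. 0 \<le> \<sigma> 0 x \<and> \<sigma> 0 x \<le> 1)"
proof (induction m)
  case 0
  \<comment> \<open>For \<open>m = 0\<close> only continuity is asked, so a piecewise linear ramp
    serves.\<close>
  show ?case
    by (rule exI[of _ "\<lambda>j x. max 0 (min 1 x)"]) (auto simp: deriv_chain_def intro!: continuous_intros)
next
  case (Suc m)
  then obtain P where P: "deriv_chain m P" "\<And>j x. j \<le> m \<Longrightarrow> x \<le> 0 \<Longrightarrow> P j x = 0"
    "\<And>x. x \<ge> real (Suc m) \<Longrightarrow> P 0 x = 1" "\<And>j x. j \<le> m \<Longrightarrow> j \<noteq> 0 \<Longrightarrow> x \<ge> real (Suc m) \<Longrightarrow> P j x = 0"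
    "\<And>x. 0 \<le> P 0 x \<and> P 0 x \<le> 1" by auto
  have "isCont (P 0) x" for x
    using deriv_chainD(2)[OF P(1), of 0 UNIV] continuous_on_eq_continuous_at by blast
  then obtain F where F: "\<And>x. (F has_real_derivative P 0 x) (at x)"
    using einterval_antiderivative[of "-\<infinity>" "\<infinity>" "P 0"]
    by (auto simp: has_real_derivative_iff_has_vector_derivative)
  define Q where "Q = (\<lambda>j x. case j of 0 \<Rightarrow> F x - F (x - 1) | Suc i \<Rightarrow> P i x - P i (x - 1))"
  \<comment> \<open>By the mean value theorem an average of \<open>P 0\<close> is one of its values,
    so the range and the constant values on both sides carry over.\<close>
  have avg: "\<exists>z. x - 1 < z \<and> z < x \<and> Q 0 x = P 0 z" for x
    using MVT2[of "x - 1" x F "P 0"] F by (auto simp: Q_def)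
  have der: "(Q j has_real_derivative Q (Suc j) x) (at x)" if "j < Suc m" for j x
  proof (cases j)
    case 0
    have "((\<lambda>x. F x - F (x - 1)) has_real_derivative P 0 x - P 0 (x - 1)) (at x)"
      by (auto intro!: derivative_eq_intros DERIV_chain2[OF F] F)
    then show ?thesis by (simp add: Q_def 0)
  next
    case (Suc i)
    have D: "(P i has_real_derivative P (Suc i) x) (at x)" for x
      using deriv_chainD(1)[OF P(1)] Suc that by auto
    have "((\<lambda>x. P i x - P i (x - 1)) has_real_derivative P (Suc i) x - P (Suc i) (x - 1)) (at x)"
      by (auto intro!: derivative_eq_intros DERIV_chain2[OF D] D)
    then show ?thesis by (simp add: Q_def Suc)
  qed
  have cont: "continuous_on UNIV (Q j)" if "j \<le> Suc m" for j
  proof (cases "j < Suc m")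
    case True
    then show ?thesis using der by (meson DERIV_continuous_on has_field_derivative_at_within)
  next
    case False
    then have [simp]: "j = Suc m" using that by simp
    show ?thesis
      by (auto simp: Q_def intro!: continuous_intros deriv_chainD(2)[OF P(1)]
          continuous_on_compose2[OF deriv_chainD(2)[OF P(1), of m UNIV]])
  qed
  have "deriv_chain (Suc m) Q" using der cont by (auto simp: deriv_chain_def)
  moreover have "Q j x = 0" if "j \<le> Suc m" "x \<le> 0" for j x
  proof (cases j)
    case 0
    then show ?thesis using avg[of x] P(2)[of 0] that by force
  next
    case (Suc i)
    then show ?thesis using P(2) that by (auto simp: Q_def)
  qed
  moreover have "Q 0 x = 1" if "x \<ge> real (Suc (Suc m))" for x
    using avg[of x] P(3) that by force
  \<comment> \<open>For \<open>j = 1\<close> the two terms are both 1 and cancel; this needs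
    \<open>x - 1\<close> to be past the old ramp.\<close>
  moreover have "Q j x = 0" if "j \<le> Suc m" "x \<ge> real (Suc (Suc m))" "j \<noteq> 0" for j x
  proof -
    obtain i where "j = Suc i" using \<open>j \<noteq> 0\<close> by (cases j) auto
    then show ?thesis using P(3)[of x] P(3)[of "x - 1"] P(4)[of i x] P(4)[of i "x - 1"] that
      by (cases "i = 0") (auto simp: Q_def)
  qed
  moreover have "0 \<le> Q 0 x \<and> Q 0 x \<le> 1" for x
    using avg[of x] P(5) by metis
  ultimately show ?case by (intro exI[of _ Q]) blast
qed

text \<open>The ramp of length \<open>m + 1\<close> is compressed to length 1; the derivatives only
  acquire powers of \<open>m + 1\<close>.\<close>

lemma ex_smooth_step:
  "\<exists>\<sigma>. deriv_chain m \<sigma> \<and> (\<forall>j\<le>m. \<forall>x\<le>0. \<sigma> j x = 0) \<and> (\<forall>x\<ge>1. \<sigma> 0 x = 1)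
     \<and> (\<forall>j\<le>m. \<forall>x\<ge>1. j \<noteq> 0 \<longrightarrow> \<sigma> j x = 0) \<and> (\<forall>x. 0 \<le> \<sigma> 0 x \<and> \<sigma> 0 x \<le> 1)"
proof -
  define K where "K = real (Suc m)"
  have "K \<ge> 1" by (simp add: K_def)
  obtain P where P: "deriv_chain m P" "\<And>j x. j \<le> m \<Longrightarrow> x \<le> 0 \<Longrightarrow> P j x = 0"
    "\<And>x. x \<ge> K \<Longrightarrow> P 0 x = 1" "\<And>j x. j \<le> m \<Longrightarrow> j \<noteq> 0 \<Longrightarrow> x \<ge> K \<Longrightarrow> P j x = 0"
    "\<And>x. 0 \<le> P 0 x \<and> P 0 x \<le> 1" using ex_deriv_chain_ramp[of m] unfolding K_def by auto
  have "K * x \<le> 0" if "x \<le> 0" for x using \<open>K \<ge> 1\<close> that by (simp add: mult_le_0_iff)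
  moreover have "K * x \<ge> K" if "x \<ge> 1" for x using \<open>K \<ge> 1\<close> that by simp
  ultimately show ?thesis
    using deriv_chain_affine[OF P(1), of K 0] P(2-5)
    by (intro exI[of _ "\<lambda>j x. K ^ j * P j (K * x + 0)"]) auto
qed

text \<open>Take the difference of two compressed steps, one rising on [-1, -1/2] and one on
  [1/2, 1].\<close>

lemma ex_smooth_plateau:
  "\<exists>\<phi>. deriv_chain m \<phi> \<and> (\<forall>j\<le>m. \<forall>x. \<bar>x\<bar> \<ge> 1 \<longrightarrow> \<phi> j x = 0)
     \<and> (\<forall>x. \<bar>x\<bar> \<le> 1/2 \<longrightarrow> \<phi> 0 x = 1) \<and> (\<forall>x. 0 \<le> \<phi> 0 x \<and> \<phi> 0 x \<le> 1)"
proof -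
  obtain P where P: "deriv_chain m P" "\<And>j x. j \<le> m \<Longrightarrow> x \<le> 0 \<Longrightarrow> P j x = 0"
    "\<And>x. x \<ge> 1 \<Longrightarrow> P 0 x = 1" "\<And>j x. j \<le> m \<Longrightarrow> j \<noteq> 0 \<Longrightarrow> x \<ge> 1 \<Longrightarrow> P j x = 0"
    "\<And>x. 0 \<le> P 0 x \<and> P 0 x \<le> 1" using ex_smooth_step[of m] by auto
  define Q where "Q = (\<lambda>j x. 2 ^ j * P j (2 * x + 2) - 2 ^ j * P j (2 * x + (-1)))"
  have "deriv_chain m Q" unfolding Q_def by (intro deriv_chain_diff deriv_chain_affine P(1))
  moreover have "Q j x = 0" if "j \<le> m" "\<bar>x\<bar> \<ge> 1" for j x
  proof (cases "x \<ge> 0")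
    case True
    then have x: "2 * x + 2 \<ge> 1" "2 * x + (-1) \<ge> 1" using that by auto
    show ?thesis using P(3,4)[OF _] x that(1) by (cases "j = 0") (auto simp: Q_def)
  next
    case False
    then show ?thesis using that by (simp add: Q_def P(2))
  qed
  moreover have "Q 0 x = 1" if "\<bar>x\<bar> \<le> 1/2" for x
  proof -
    have "2 * x + 2 \<ge> 1" "2 * x + (-1) \<le> 0" using that by (auto simp: abs_le_iff)
    then show ?thesis by (simp only: Q_def P(2,3)) simp
  qed
  moreover have "0 \<le> Q 0 x \<and> Q 0 x \<le> 1" for x
  proof (cases "x \<le> 1/2")
    case True
    then show ?thesis using P(5) by (simp add: Q_def P(2))
  next
    case False
    then have "2 * x + 2 \<ge> 1" by simp
    then show ?thesis using P(5)[of "2 * x + (-1)"] by (simp add: Q_def P(3))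
  qed
  ultimately show ?thesis by (intro exI[of _ Q]) blast
qed

text \<open>Compactness of [-1, 1] bounds each derivative there, and the hypothesis bounds it
  elsewhere; summing the finitely many bounds makes the constant uniform in
  \<open>j\<close>.\<close>

lemma deriv_chain_bounded:
  assumes "deriv_chain m g" and "\<And>j x. j \<le> m \<Longrightarrow> \<bar>x\<bar> \<ge> 1 \<Longrightarrow> \<bar>g j x\<bar> \<le> 1"
  shows "\<exists>B\<ge>1. \<forall>j\<le>m. \<forall>x. \<bar>g j x\<bar> \<le> B"
proof -
  have "\<exists>C. \<forall>x. \<bar>g j x\<bar> \<le> C" if "j \<le> m" for j
  proof -
    have "bounded (g j ` {-1..1})"
      using assms(1) that
      by (intro compact_imp_bounded compact_continuous_image deriv_chainD(2)) auto
    then obtain C where "\<forall>x\<in>{-1..1}. \<bar>g j x\<bar> \<le> C"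
      by (auto simp: bounded_iff)
    then have C: "\<bar>g j x\<bar> \<le> C" if "-1 \<le> x" "x \<le> 1" for x using that by simp
    have "\<bar>g j x\<bar> \<le> max 1 C" for x
    proof (cases "\<bar>x\<bar> \<ge> 1")
      case True
      then show ?thesis using assms(2)[OF that True] by simp
    next
      case False
      then have "-1 \<le> x" "x \<le> 1" by linarith+
      then show ?thesis using C[of x] by linarith
    qed
    then show ?thesis by blast
  qed
  then obtain C where C: "\<And>j x. j \<le> m \<Longrightarrow> \<bar>g j x\<bar> \<le> C j" by metis
  show ?thesis
  proof (intro exI[of _ "1 + (\<Sum>j\<le>m. \<bar>C j\<bar>)"] conjI allI impI)
    fix j x assume "j \<le> m"
    then have "\<bar>C j\<bar> \<le> (\<Sum>j\<le>m. \<bar>C j\<bar>)" by (intro member_le_sum) auto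
    then show "\<bar>g j x\<bar> \<le> 1 + (\<Sum>j\<le>m. \<bar>C j\<bar>)" using C[OF \<open>j \<le> m\<close>, of x] by linarith
  qed (simp add: sum_nonneg)
qed

section \<open>Iterated partial derivatives\<close>

text \<open>\<open>G es\<close> plays the role of the iterated partial derivative of \<open>G []\<close> in the directions \<open>es\<close>.\<close>

definition derivative_family :: "nat \<Rightarrow> 'a::euclidean_space set \<Rightarrow> ('a list \<Rightarrow> 'a \<Rightarrow> real) \<Rightarrow> bool" where
  "derivative_family m S G \<longleftrightarrow>
     (\<forall>es. set es \<subseteq> Basis \<and> length es \<le> m \<longrightarrow> continuous_on S (G es)) \<and>
     (\<forall>es e p. set es \<subseteq> Basis \<and> length es < m \<and> e \<in> Basis \<and> p \<in> S \<longrightarrow>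
        ((\<lambda>s. G es (p + s *\<^sub>R e)) has_real_derivative G (e # es) p) (at 0 within {s. p + s *\<^sub>R e \<in> S}))"

lemma derivative_family_add:
  assumes "derivative_family m S F" "derivative_family m S G"
  shows "derivative_family m S (\<lambda>es p. F es p + G es p)"
  using assms unfolding derivative_family_def by (simp add: DERIV_add continuous_on_add)

lemma derivative_family_cmult:
  assumes "derivative_family m S G"
  shows "derivative_family m S (\<lambda>es p. c * G es p)"
  using assms unfolding derivative_family_def by (simp add: DERIV_cmult continuous_on_mult_left)

text \<open>\<open>vector_derivative\<close> is a choice among derivatives, so it can be computed
  only where derivatives are unique. \<open>nontriv\<close> gives this: 0 is not isolated in the set
  of admissible \<open>s\<close>.\<close>

lemma iterated_partial_eq_family:
  assumes "derivative_family m S G"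
    and nontriv: "\<And>p e. p \<in> S \<Longrightarrow> e \<in> Basis \<Longrightarrow> at 0 within {s. p + s *\<^sub>R e \<in> S} \<noteq> bot"
    and "set es \<subseteq> Basis" "length es \<le> m" "p \<in> S"
  shows "iterated_partial S es (G []) p = G es p"
  using assms(3-5)
proof (induction es arbitrary: p)
  case Nil
  then show ?case by simp
next
  case (Cons e es)
  let ?T = "{s. p + s *\<^sub>R e \<in> S}"
  have "((\<lambda>s. G es (p + s *\<^sub>R e)) has_vector_derivative G (e # es) p) (at 0 within ?T)"
    using assms(1) Cons.prems
    by (auto simp: derivative_family_def has_real_derivative_iff_has_vector_derivative)
  \<comment> \<open>The induction hypothesis holds on \<open>S\<close> only, which suffices because
    the filter only sees points of \<open>S\<close>.\<close>
  then have "((\<lambda>s. iterated_partial S es (G []) (p + s *\<^sub>R e)) has_vector_derivative G (e # es) p) (at 0 within ?T)"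
    using Cons by (elim has_vector_derivative_transform[rotated 2]) auto
  then show ?case
    using nontriv[of p e] Cons.prems by (simp add: partial_derivative_def vector_derivative_within)
qed

lemma Cr_on_family:
  fixes S :: "'a::euclidean_space set"
  assumes "derivative_family m S G"
    and nontriv: "\<And>p e. p \<in> S \<Longrightarrow> e \<in> Basis \<Longrightarrow> at 0 within {s. p + s *\<^sub>R e \<in> S} \<noteq> bot"
  shows "Cr_on m S (G [])"
  unfolding Cr_on_def
proof (intro conjI allI impI ballI)
  fix es :: "'a list" assume es: "set es \<subseteq> Basis \<and> length es \<le> m"
  then have "continuous_on S (G es)" using assms(1) by (auto simp: derivative_family_def)
  then show "continuous_on S (iterated_partial S es (G []))"
    using iterated_partial_eq_family[OF assms] es by (simp cong: continuous_on_cong)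
next
  fix es :: "'a list" and e p :: 'a assume es: "set es \<subseteq> Basis \<and> length es < m" and "e \<in> Basis" "p \<in> S"
  let ?T = "{s. p + s *\<^sub>R e \<in> S}"
  have "((\<lambda>s. G es (p + s *\<^sub>R e)) has_vector_derivative G (e # es) p) (at 0 within ?T)"
    using assms(1) es \<open>e \<in> Basis\<close> \<open>p \<in> S\<close>
    by (auto simp: derivative_family_def has_real_derivative_iff_has_vector_derivative)
  then have "((\<lambda>s. iterated_partial S es (G []) (p + s *\<^sub>R e)) has_vector_derivative G (e # es) p) (at 0 within ?T)"
    using iterated_partial_eq_family[OF assms] es \<open>p \<in> S\<close>
    by (elim has_vector_derivative_transform[rotated 2]) auto
  then show "(\<lambda>s. iterated_partial S es (G []) (p + s *\<^sub>R e)) differentiable (at 0 within ?T)"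
    by (rule differentiableI_vector)
qed

section \<open>Functions with separated variables\<close>

text \<open>The product of one-variable functions, already differentiated along \<open>es\<close>: a
  derivative in direction \<open>u\<close> hits only the factor of \<open>u\<close>, so only the
  multiplicity of \<open>u\<close> in \<open>es\<close> matters.\<close>

definition tensor :: "('a::euclidean_space \<Rightarrow> nat \<Rightarrow> real \<Rightarrow> real) \<Rightarrow> 'a list \<Rightarrow> 'a \<Rightarrow> real" where
  "tensor g es p = (\<Prod>u\<in>Basis. g u (count_list es u) (p \<bullet> u))"

lemma count_list_le_length: "count_list xs x \<le> length xs"
  by (induction xs) auto

lemma derivative_family_tensor:
  fixes g :: "'a::euclidean_space \<Rightarrow> nat \<Rightarrow> real \<Rightarrow> real"
  assumes "\<And>u. u \<in> Basis \<Longrightarrow> deriv_chain m (g u)"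
  shows "derivative_family m S (tensor g)"
  unfolding derivative_family_def
proof (intro conjI allI impI)
  fix es :: "'a list" assume es: "set es \<subseteq> Basis \<and> length es \<le> m"
  then have *: "count_list es u \<le> m" for u using count_list_le_length[of es u] by simp
  show "continuous_on S (tensor g es)"
    unfolding tensor_def
    by (intro continuous_intros continuous_on_compose2[OF deriv_chainD(2)[OF assms *, of _ UNIV]]) auto
next
  fix es :: "'a list" and e p :: 'a
  assume es: "set es \<subseteq> Basis \<and> length es < m \<and> e \<in> Basis \<and> p \<in> S"
  then have e: "e \<in> Basis" and c: "count_list es e < m" using count_list_le_length[of es e] by auto
  define K where "K = (\<Prod>u\<in>Basis-{e}. g u (count_list es u) (p \<bullet> u))"
  have 1: "tensor g es (p + s *\<^sub>R e) = g e (count_list es e) (s + p \<bullet> e) * K" for s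
  proof -
    have "(p + s *\<^sub>R e) \<bullet> u = p \<bullet> u" if "u \<in> Basis - {e}" for u
      using that e by (auto simp: inner_add_left inner_Basis)
    then have "(\<Prod>u\<in>Basis-{e}. g u (count_list es u) ((p + s *\<^sub>R e) \<bullet> u)) = K"
      unfolding K_def by (intro prod.cong) auto
    then show ?thesis unfolding tensor_def
      using e by (subst prod.remove[of _ e]) (auto simp: inner_add_left add.commute)
  qed
  have 2: "tensor g (e # es) p = g e (Suc (count_list es e)) (0 + p \<bullet> e) * K"
  proof -
    have "(\<Prod>u\<in>Basis-{e}. g u (count_list (e # es) u) (p \<bullet> u)) = K"
      unfolding K_def by (intro prod.cong) auto
    then show ?thesis unfolding tensor_def using e by (subst prod.remove[of _ e]) auto
  qed
  have "((\<lambda>s. g e (count_list es e) (s + p \<bullet> e) * K) has_real_derivative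
         g e (Suc (count_list es e)) (0 + p \<bullet> e) * K) (at 0)"
    by (auto intro!: derivative_eq_intros DERIV_chain2[OF deriv_chainD(1)[OF assms[OF e] c]])
  then show "((\<lambda>s. tensor g es (p + s *\<^sub>R e)) has_real_derivative tensor g (e # es) p)
          (at 0 within {s. p + s *\<^sub>R e \<in> S})"
    unfolding 1 2 by (rule has_field_derivative_at_within)
qed

text \<open>The multiplicities of the directions add up to \<open>length es\<close>, so the powers
  of \<open>W\<close> combine, while each of the variables contributes one factor
  \<open>C\<close>.\<close>

lemma abs_tensor_le:
  fixes g :: "'a::euclidean_space \<Rightarrow> nat \<Rightarrow> real \<Rightarrow> real"
  assumes "\<And>u j x. u \<in> Basis \<Longrightarrow> j \<le> m \<Longrightarrow> \<bar>g u j x\<bar> \<le> C * W ^ j"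
    and "set es \<subseteq> Basis" "length es \<le> m"
  shows "\<bar>tensor g es p\<bar> \<le> C ^ DIM('a) * W ^ length es"
proof -
  have "\<bar>tensor g es p\<bar> = (\<Prod>u\<in>Basis. \<bar>g u (count_list es u) (p \<bullet> u)\<bar>)"
    by (simp add: tensor_def abs_prod)
  also have "\<dots> \<le> (\<Prod>u\<in>Basis. C * W ^ count_list es u)"
    using assms(1,3) count_list_le_length[of es] by (intro prod_mono) (meson abs_ge_zero le_trans)
  also have "\<dots> = C ^ DIM('a) * W ^ (\<Sum>u\<in>Basis. count_list es u)"
    by (simp add: prod.distrib power_sum)
  also have "(\<Sum>u\<in>Basis. count_list es u) = length es"
    using assms(2) by (intro sum_count_set) auto
  finally show ?thesis .
qed

lemma prod_Basis_strip:
  fixes h :: "real \<times> (real ^ 'd) \<Rightarrow> real"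
  shows "(\<Prod>u\<in>Basis. h u) = h (1, 0) * (\<Prod>k\<in>UNIV. h (0, axis k 1))"
proof -
  let ?A = "range (\<lambda>k. (0::real, axis k 1 :: (real ^ 'd)))"
  have B: "Basis = insert (1, 0) ?A"
    by (auto simp: Basis_prod_def Basis_vec_def image_iff)
  have "(\<Prod>u\<in>Basis. h u) = prod h (insert (1, 0) ?A)"
    by (rule arg_cong[OF B])
  also have "\<dots> = h (1, 0) * prod h ?A"
    by (rule prod.insert) auto
  also have "prod h ?A = (\<Prod>k\<in>UNIV. h (0, axis k 1))"
    by (subst prod.reindex) (auto simp: inj_def axis_eq_axis)
  finally show ?thesis .
qed

text \<open>Supplies \<open>nontriv\<close> for the strip. In the time direction the admissible
  \<open>s\<close> form an interval of positive length containing 0, possibly as an endpoint; in the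
  other directions they fill the line.\<close>

lemma at_within_line_strip_ne_bot:
  fixes p e :: "real \<times> (real ^ 'd)"
  assumes "a < b" "p \<in> strip a b" "e \<in> Basis"
  shows "at 0 within {s. p + s *\<^sub>R e \<in> strip a b} \<noteq> bot"
proof (cases "e = (1, 0)")
  case True
  have *: "{s. p + s *\<^sub>R e \<in> strip a b} = {a - fst p..b - fst p}"
    by (cases p) (auto simp: True)
  show ?thesis unfolding *
    using assms by (auto simp: trivial_limit_within islimpt_Icc)
next
  case False
  then have "{s. p + s *\<^sub>R e \<in> strip a b} = UNIV"
    using assms by (cases p) (auto simp: Basis_prod_def)
  then show ?thesis by simp
qed

section \<open>Uniqueness of solutions\<close>

text \<open>Gronwall's argument: the squared distance times \<open>exp (- (2 * L * t))\<close> has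
  nonpositive derivative and starts at 0. It identifies the solution that
  \<open>ivp_solution\<close> picks by choice.\<close>

lemma ivp_solution_unique:
  fixes f :: "real \<times> (real ^ 'd) \<Rightarrow> real ^ 'd"
  assumes lip: "\<And>t x y. t \<in> {a..b} \<Longrightarrow> norm (f (t, x) - f (t, y)) \<le> L * norm (x - y)"
    and z: "ivp_solves a b \<eta> f z" and w: "ivp_solves a b \<eta> f w" and t: "t \<in> {a..b}"
  shows "z t = w t"
proof -
  define E where "E = (\<lambda>t. ((z t - w t) \<bullet> (z t - w t)) * exp (- (2 * L * t)))"
  define E' where "E' = (\<lambda>t. (2 * ((z t - w t) \<bullet> (f (t, z t) - f (t, w t)))
      - 2 * L * ((z t - w t) \<bullet> (z t - w t))) * exp (- (2 * L * t)))"
  have der: "(E has_real_derivative E' s) (at s within {a..b})" if "s \<in> {a..b}" for s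
  proof -
    have 1: "((\<lambda>s. z s - w s) has_vector_derivative f (s, z s) - f (s, w s)) (at s within {a..b})"
      using z w that by (auto simp: ivp_solves_def intro!: has_vector_derivative_diff)
    have "((\<lambda>s. (z s - w s) \<bullet> (z s - w s)) has_vector_derivative
        (z s - w s) \<bullet> (f (s, z s) - f (s, w s)) + (f (s, z s) - f (s, w s)) \<bullet> (z s - w s)) (at s within {a..b})"
      by (rule bounded_bilinear.has_vector_derivative[OF bounded_bilinear_inner 1 1])
    then have "((\<lambda>s. (z s - w s) \<bullet> (z s - w s)) has_real_derivative
        2 * ((z s - w s) \<bullet> (f (s, z s) - f (s, w s)))) (at s within {a..b})"
      by (simp add: has_real_derivative_iff_has_vector_derivative inner_commute)
    moreover have "((\<lambda>s. exp (- (2 * L * s))) has_real_derivative - (2 * L) * exp (- (2 * L * s))) (at s within {a..b})"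
      by (auto intro!: derivative_eq_intros)
    ultimately show ?thesis unfolding E_def E'_def
      by (rule DERIV_cong[OF DERIV_mult]) (simp add: algebra_simps)
  qed
  have neg: "E' s \<le> 0" if "s \<in> {a..b}" for s
  proof -
    have "(z s - w s) \<bullet> (f (s, z s) - f (s, w s)) \<le> norm (z s - w s) * norm (f (s, z s) - f (s, w s))"
      by (rule norm_cauchy_schwarz)
    also have "\<dots> \<le> norm (z s - w s) * (L * norm (z s - w s))"
      by (intro mult_left_mono lip that) simp
    also have "\<dots> = L * ((z s - w s) \<bullet> (z s - w s))"
      by (simp add: dot_square_norm power2_eq_square)
    finally show ?thesis unfolding E'_def by (simp add: mult_le_0_iff)
  qed
  have "E t \<le> E a"
  proof (cases "t = a")
    case False
    then have "a < t" using t by simp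
    have "\<exists>x\<in>{a<..<t}. E t - E a = (t - a) * E' x"
    proof -
      have "(E has_derivative (\<lambda>y. y * E' x)) (at x within {a..t})" if "x \<in> {a..t}" for x
      proof -
        have "(E has_real_derivative E' x) (at x within {a..t})"
          using DERIV_subset[OF der[of x], of "{a..t}"] that t by auto
        then show ?thesis by (simp add: has_field_derivative_def mult_commute_abs)
      qed
      then show ?thesis using mvt_simple[OF \<open>a < t\<close>, of E "\<lambda>x y. y * E' x"] by auto
    qed
    then obtain x where "x \<in> {a<..<t}" "E t - E a = (t - a) * E' x" by blast
    then show ?thesis using neg[of x] t mult_nonneg_nonpos[of "t - a" "E' x"] by auto
  qed simp
  then have "E t \<le> 0" using z w by (simp add: E_def ivp_solves_def)
  then have "(z t - w t) \<bullet> (z t - w t) \<le> 0" by (simp add: E_def mult_le_0_iff)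
  then have "(z t - w t) \<bullet> (z t - w t) = 0" by (intro antisym) auto
  then show ?thesis by simp
qed

section \<open>Pulses in time and tubes in space\<close>

text \<open>\<open>\<sigma>\<close> has one derivative more than \<open>\<phi>\<close> because the
  field contains its derivative as a time profile, while \<open>\<sigma>\<close> itself describes
  the motion of the solution.\<close>

locale cutoffs =
  fixes r :: nat and \<sigma> \<phi> :: "nat \<Rightarrow> real \<Rightarrow> real" and B :: real
  assumes r: "r \<ge> 1"
    and \<sigma>_chain: "deriv_chain (Suc r) \<sigma>"
    and \<sigma>_left: "j \<le> Suc r \<Longrightarrow> x \<le> 0 \<Longrightarrow> \<sigma> j x = 0"
    and \<sigma>_right: "x \<ge> 1 \<Longrightarrow> \<sigma> 0 x = 1"
    and \<sigma>_deriv_right: "j \<le> Suc r \<Longrightarrow> j \<noteq> 0 \<Longrightarrow> x \<ge> 1 \<Longrightarrow> \<sigma> j x = 0"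
    and \<sigma>_range: "0 \<le> \<sigma> 0 x" "\<sigma> 0 x \<le> 1"
    and \<phi>_chain: "deriv_chain r \<phi>"
    and \<phi>_outside: "j \<le> r \<Longrightarrow> \<bar>x\<bar> \<ge> 1 \<Longrightarrow> \<phi> j x = 0"
    and \<phi>_inside: "\<bar>x\<bar> \<le> 1/2 \<Longrightarrow> \<phi> 0 x = 1"
    and \<phi>_range: "0 \<le> \<phi> 0 x" "\<phi> 0 x \<le> 1"
    and B_ge_1: "B \<ge> 1"
    and \<sigma>_bound: "j \<le> Suc r \<Longrightarrow> \<bar>\<sigma> j x\<bar> \<le> B"
    and \<phi>_bound: "j \<le> r \<Longrightarrow> \<bar>\<phi> j x\<bar> \<le> B"
begin

text \<open>For \<open>j = 0\<close> a sum of bumps of integral \<open>\<tau>\<close>, one for each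
  time cell from \<open>s + i * \<tau>\<close> to \<open>s + (i + 1) * \<tau>\<close> with
  \<open>i\<close> in \<open>I\<close>; larger \<open>j\<close> gives the derivatives.\<close>

definition pulses :: "nat set \<Rightarrow> real \<Rightarrow> real \<Rightarrow> nat \<Rightarrow> real \<Rightarrow> real" where
  "pulses I \<tau> s j t = (1/\<tau>) ^ j * (\<Sum>i\<in>I. \<sigma> (Suc j) ((1/\<tau>) * t + - (s/\<tau>) - real i))"

text \<open>The antiderivative of \<open>pulses I \<tau> s 0\<close> divided by
  \<open>\<tau>\<close>: it counts the completed pulses and interpolates within a cell.\<close>

definition steps :: "nat set \<Rightarrow> real \<Rightarrow> real \<Rightarrow> real \<Rightarrow> real" where
  "steps I \<tau> s t = (\<Sum>i\<in>I. \<sigma> 0 ((1/\<tau>) * t + - (s/\<tau>) - real i))"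

lemma pulses_chain: "deriv_chain r (pulses I \<tau> s)"
proof -
  have "deriv_chain r (\<lambda>j. \<sigma> (Suc j))" by (rule deriv_chain_Suc[OF \<sigma>_chain])
  then have "deriv_chain r (\<lambda>j x. 1 ^ j * \<sigma> (Suc j) (1 * x + - real i))" for i
    by (rule deriv_chain_affine)
  then have "deriv_chain r (\<lambda>j x. \<Sum>i\<in>I. \<sigma> (Suc j) (x - real i))"
    by (intro deriv_chain_sum) simp
  then have "deriv_chain r (\<lambda>j x. (1/\<tau>) ^ j * (\<Sum>i\<in>I. \<sigma> (Suc j) ((1/\<tau>) * x + - (s/\<tau>) - real i)))"
    by (rule deriv_chain_affine)
  then show ?thesis by (simp only: pulses_def[abs_def])
qed

lemma \<sigma>_deriv_eq_0_if:
  assumes "j \<le> r" "nat \<lfloor>x\<rfloor> \<noteq> i"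
  shows "\<sigma> (Suc j) (x - real i) = 0"
proof (cases "x - real i \<le> 0")
  case True
  then show ?thesis using \<sigma>_left assms by simp
next
  case False
  have "x - real i \<ge> 1"
  proof (rule ccontr)
    assume "\<not> x - real i \<ge> 1"
    with False have "\<lfloor>x\<rfloor> = int i" by (intro floor_unique) auto
    then show False using assms(2) by simp
  qed
  then show ?thesis using \<sigma>_deriv_right[of "Suc j"] assms by simp
qed

text \<open>The pulses have disjoint supports, so at most one summand is nonzero at each
  \<open>t\<close> and the bound does not grow with \<open>card I\<close>.\<close>

lemma abs_pulses_le:
  assumes "finite I" "j \<le> r" "\<tau> > 0"
  shows "\<bar>pulses I \<tau> s j t\<bar> \<le> B * (1/\<tau>) ^ j"
proof -
  let ?x = "(1/\<tau>) * t + - (s/\<tau>)"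
  have "(\<Sum>i\<in>I. \<sigma> (Suc j) (?x - real i)) = (\<Sum>i\<in>I \<inter> {nat \<lfloor>?x\<rfloor>}. \<sigma> (Suc j) (?x - real i))"
    using assms by (intro sum.mono_neutral_right) (auto intro!: \<sigma>_deriv_eq_0_if)
  also have "\<bar>\<dots>\<bar> \<le> B"
    using \<sigma>_bound[of "Suc j"] assms B_ge_1 by (cases "nat \<lfloor>?x\<rfloor> \<in> I") auto
  finally have "(1/\<tau>) ^ j * \<bar>\<Sum>i\<in>I. \<sigma> (Suc j) (?x - real i)\<bar> \<le> (1/\<tau>) ^ j * B"
    using assms(3) by (intro mult_left_mono) auto
  then show ?thesis using assms(3) by (simp add: pulses_def abs_mult mult.commute)
qed

lemma pulses_eq_0:
  assumes "\<tau> > 0" "j \<le> r" "\<And>i. i \<in> I \<Longrightarrow> \<not> (s + real i * \<tau> < t \<and> t < s + (real i + 1) * \<tau>)"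
  shows "pulses I \<tau> s j t = 0"
proof -
  have "\<sigma> (Suc j) ((1/\<tau>) * t + - (s/\<tau>) - real i) = 0" if "i \<in> I" for i
  proof -
    have "(1/\<tau>) * t + - (s/\<tau>) - real i \<le> 0 \<or> (1/\<tau>) * t + - (s/\<tau>) - real i \<ge> 1"
      using assms(3)[OF that] assms(1) by (simp add: field_simps) argo
    then show ?thesis using \<sigma>_left[of "Suc j"] \<sigma>_deriv_right[of "Suc j"] assms(2) by auto
  qed
  then show ?thesis by (simp add: pulses_def)
qed

lemma steps_eq_0:
  assumes "\<tau> > 0" "t \<le> s"
  shows "steps I \<tau> s t = 0"
proof -
  have "t / \<tau> - s / \<tau> \<le> 0" using assms by (simp add: field_simps)
  then have "(1/\<tau>) * t + - (s/\<tau>) - real i \<le> 0" for i by simp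
  then show ?thesis using \<sigma>_left[of 0] by (simp add: steps_def)
qed

lemma steps_eq_card:
  assumes "\<tau> > 0" "\<And>i. i \<in> I \<Longrightarrow> s + (real i + 1) * \<tau> \<le> t"
  shows "steps I \<tau> s t = real (card I)"
proof -
  have "\<sigma> 0 ((1/\<tau>) * t + - (s/\<tau>) - real i) = 1" if "i \<in> I" for i
  proof (rule \<sigma>_right)
    have "s + (real i + 1) * \<tau> \<le> t" by (rule assms(2)[OF that])
    then have "(s + (real i + 1) * \<tau>) / \<tau> \<le> t / \<tau>" using assms(1) by (simp add: divide_right_mono)
    then show "1 \<le> (1/\<tau>) * t + - (s/\<tau>) - real i" using assms(1) by (auto simp: add_divide_distrib)
  qed
  then show ?thesis by (simp add: steps_def)
qed

lemma steps_range: "0 \<le> steps I \<tau> s t" "steps I \<tau> s t \<le> real (card I)"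
proof -
  show "0 \<le> steps I \<tau> s t" unfolding steps_def by (intro sum_nonneg \<sigma>_range)
  have "steps I \<tau> s t \<le> (\<Sum>i\<in>I. 1)" unfolding steps_def by (intro sum_mono \<sigma>_range)
  then show "steps I \<tau> s t \<le> real (card I)" by simp
qed

lemma has_derivative_steps:
  "(steps I \<tau> s has_real_derivative pulses I \<tau> s 0 t / \<tau>) (at t within A)"
proof -
  have lin: "((\<lambda>t. k * t + l - m) has_real_derivative k) (at t)" for k l m :: real
    by (auto intro!: derivative_eq_intros)
  have "((\<lambda>t. \<sigma> 0 ((1/\<tau>) * t + - (s/\<tau>) - real i)) has_real_derivative
      \<sigma> (Suc 0) ((1/\<tau>) * t + - (s/\<tau>) - real i) * (1/\<tau>)) (at t)" for i
    by (rule DERIV_chain2[OF deriv_chainD(1)[OF \<sigma>_chain] lin]) simp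
  then have "((\<lambda>t. \<Sum>i\<in>I. \<sigma> 0 ((1/\<tau>) * t + - (s/\<tau>) - real i)) has_real_derivative
      (\<Sum>i\<in>I. \<sigma> (Suc 0) ((1/\<tau>) * t + - (s/\<tau>) - real i) * (1/\<tau>))) (at t)"
    by (intro DERIV_sum) auto
  then have "(steps I \<tau> s has_real_derivative pulses I \<tau> s 0 t / \<tau>) (at t)"
    by (simp add: steps_def[abs_def] pulses_def sum_divide_distrib)
  then show ?thesis by (rule has_field_derivative_at_within)
qed

section \<open>Products of a time profile and a spatial cut-off\<close>

definition tube :: "(nat \<Rightarrow> real \<Rightarrow> real) \<Rightarrow> real \<Rightarrow> real ^ 'd \<Rightarrow>
    real \<times> (real ^ 'd) \<Rightarrow> nat \<Rightarrow> real \<Rightarrow> real" where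
  "tube T w c u = (if u = (1, 0) then T
     else (\<lambda>j x. (1/w) ^ j * \<phi> j ((1/w) * x + - ((0, c) \<bullet> u / w))))"

lemma tube_chain: "deriv_chain r T \<Longrightarrow> deriv_chain r (tube T w c u)"
  unfolding tube_def by (simp only: deriv_chain_affine[OF \<phi>_chain] split: if_split) simp

text \<open>\<open>(1, 0)\<close> is the time direction. The spatial factors form a cut-off that
  lives on the cube of half-width \<open>w\<close> about \<open>c\<close>.\<close>

lemma tensor_tube:
  fixes c :: "real ^ 'd"
  shows "tensor (tube T w c) es (t, y) = T (count_list es (1, 0)) t *
    (\<Prod>k\<in>UNIV. (1/w) ^ count_list es (0, axis k 1) * \<phi> (count_list es (0, axis k 1)) ((y $ k - c $ k) / w))"
proof -
  have "(1/w) * y $ k + - ((0, c) \<bullet> (0, axis k 1) / w) = (y $ k - c $ k) / w" for k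
    by (simp add: inner_axis diff_divide_distrib)
  then show ?thesis
    unfolding tensor_def prod_Basis_strip by (simp add: tube_def inner_axis)
qed

lemma tensor_tube_Nil:
  "tensor (tube T w c) [] (t, y) = T 0 t * (\<Prod>k\<in>UNIV. \<phi> 0 ((y $ k - c $ k) / w))"
  by (simp add: tensor_tube)

lemma tensor_tube_eq_0_space:
  assumes "w > 0" "length es \<le> r" "\<bar>y $ k - c $ k\<bar> \<ge> w"
  shows "tensor (tube T w c) es (t, y) = 0"
proof -
  have "\<phi> (count_list es (0, axis k 1)) ((y $ k - c $ k) / w) = 0"
    using assms count_list_le_length[of es "(0, axis k 1)"] by (intro \<phi>_outside) auto
  then show ?thesis by (auto simp: tensor_tube)
qed

text \<open>A single rate \<open>W\<close> dominates both the time scale of \<open>T\<close> and the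
  space scale \<open>1/w\<close>, so the order of the derivative alone determines the bound.\<close>

lemma abs_tensor_tube_le:
  fixes c :: "real ^ 'd"
  assumes T: "\<And>j x. j \<le> r \<Longrightarrow> \<bar>T j x\<bar> \<le> B * W ^ j"
    and w: "w > 0" "1/w \<le> W" and es: "set es \<subseteq> Basis" "length es \<le> r"
  shows "\<bar>tensor (tube T w c) es p\<bar> \<le> B ^ DIM(real \<times> (real ^ 'd)) * W ^ length es"
proof (rule abs_tensor_le[OF _ es])
  fix u :: "real \<times> (real ^ 'd)" and j x assume "j \<le> r"
  have "(1/w) ^ j * \<bar>\<phi> j z\<bar> \<le> W ^ j * B" for z
  proof -
    have "0 \<le> 1 / w" using w by simp
    then have "(1/w) ^ j \<le> W ^ j" "0 \<le> W ^ j" using w(2) power_mono[of "1/w" W j] zero_le_power[of W j] by linarith+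
    then show ?thesis using \<phi>_bound[OF \<open>j \<le> r\<close>, of z] by (intro mult_mono) auto
  qed
  then show "\<bar>tube T w c u j x\<bar> \<le> B * W ^ j"
    using T[OF \<open>j \<le> r\<close>] w(1) by (simp add: tube_def abs_mult mult.commute[of B])
qed

lemma \<phi>_lipschitz: "\<bar>\<phi> 0 x - \<phi> 0 y\<bar> \<le> B * \<bar>x - y\<bar>"
proof -
  have "norm (\<phi> 0 x - \<phi> 0 y) \<le> B * norm (x - y)"
    using r \<phi>_bound[of 1] deriv_chainD(1)[OF \<phi>_chain, of 0]
    by (intro field_differentiable_bound[of UNIV _ "\<phi> (Suc 0)"]) auto
  then show ?thesis by simp
qed

lemma tensor_tube_lipschitz:
  fixes c :: "real ^ 'd"
  assumes "\<bar>T 0 t\<bar> \<le> C" "w > 0"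
  shows "\<bar>tensor (tube T w c) [] (t, x) - tensor (tube T w c) [] (t, y)\<bar>
    \<le> C * (real CARD('d) * (B / w)) * norm (x - y)"
proof -
  let ?P = "\<lambda>y. \<Prod>k\<in>UNIV. \<phi> 0 ((y $ k - c $ k) / w)"
  \<comment> \<open>Telescoping the product works because all factors lie in [0, 1].\<close>
  have "norm (?P x - ?P y) \<le> (\<Sum>k\<in>UNIV. norm (\<phi> 0 ((x $ k - c $ k) / w) - \<phi> 0 ((y $ k - c $ k) / w)))"
    using \<phi>_range by (intro norm_prod_diff) auto
  also have "\<dots> \<le> (\<Sum>k\<in>(UNIV::'d set). (B / w) * norm (x - y))"
  proof (intro sum_mono)
    fix k
    have "norm (\<phi> 0 ((x $ k - c $ k) / w) - \<phi> 0 ((y $ k - c $ k) / w))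
        \<le> B * \<bar>(x $ k - c $ k) / w - (y $ k - c $ k) / w\<bar>"
      using \<phi>_lipschitz by simp
    also have "\<dots> = (B / w) * \<bar>(x - y) $ k\<bar>"
      using assms(2) by (simp add: diff_divide_distrib[symmetric])
    also have "\<dots> \<le> (B / w) * norm (x - y)"
      using assms(2) B_ge_1 component_le_norm_cart[of "x - y" k] by (intro mult_left_mono) auto
    finally show "norm (\<phi> 0 ((x $ k - c $ k) / w) - \<phi> 0 ((y $ k - c $ k) / w)) \<le> (B / w) * norm (x - y)" .
  qed
  finally have *: "\<bar>?P x - ?P y\<bar> \<le> real CARD('d) * (B / w) * norm (x - y)" by simp
  have "\<bar>tensor (tube T w c) [] (t, x) - tensor (tube T w c) [] (t, y)\<bar> = \<bar>T 0 t\<bar> * \<bar>?P x - ?P y\<bar>"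
    by (simp add: tensor_tube_Nil abs_mult right_diff_distrib[symmetric])
  also have "\<dots> \<le> C * (real CARD('d) * (B / w) * norm (x - y))"
    using assms(1) * by (intro mult_mono) auto
  finally show ?thesis by (simp add: mult_ac)
qed

text \<open>On the plateau the field depends on time alone, so a trajectory that stays there is
  found by integrating the time profile.\<close>

lemma tensor_tube_eq_time:
  assumes "w > 0" "\<And>k. \<bar>y $ k - c $ k\<bar> \<le> w / 2"
  shows "tensor (tube T w c) [] (t, y) = T 0 t"
proof -
  have "\<phi> 0 ((y $ k - c $ k) / w) = 1" for k
    using assms by (intro \<phi>_inside) (simp add: field_simps)
  then show ?thesis by (simp add: tensor_tube_Nil)
qed

end

section \<open>Fields that agree on the sample points\<close>

text \<open>The parameter \<open>N\<close> is the number of cells per coordinate: the second half of the time interval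
  is cut into \<open>N\<close> intervals, and the shifts \<open>v\<close> reachable during the first half range over a cube of
  side \<open>\<rho>\<close> cut into cells of side \<open>\<rho> / N\<close>, with \<open>\<eta> + v\<close> meant as the centre of a cell. The bumps have
  height \<open>c / N ^ r\<close>, which is what the bound \<open>D\<close> on the derivatives of order \<open>r\<close> allows; \<open>I\<close> is the set of
  time cells carrying one.\<close>

locale fooling = cutoffs r \<sigma> \<phi> B for r \<sigma> \<phi> B +
  fixes a b D :: real and M :: "(real ^ 'd) set" and \<eta> v :: "real ^ 'd" and j\<^sub>0 :: 'd
    and R \<rho> c W\<^sub>0 W\<^sub>1 :: real and N :: nat
  assumes ab: "a < b" and R: "R > 0" and box: "(\<And>k. \<bar>y $ k - \<eta> $ k\<bar> < R) \<Longrightarrow> y \<in> M"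
    and \<rho>: "\<rho> > 0" "\<rho> \<le> R / 2" and N: "N \<ge> 1" and c: "c > 0" "c * ((b - a) / 2) \<le> \<rho> / 4"
    and v: "\<rho> / (2 * N) \<le> v $ k" "v $ k \<le> \<rho> - \<rho> / (2 * N)"
    and W\<^sub>0: "W\<^sub>0 \<ge> 1" "1 / ((b - a) / 2) \<le> W\<^sub>0" "1 / R \<le> W\<^sub>0"
    and W\<^sub>1: "W\<^sub>1 \<ge> 1" "1 / ((b - a) / 2) \<le> W\<^sub>1" "2 / \<rho> \<le> W\<^sub>1"
    and \<rho>_small: "\<rho> / ((b - a) / 2) * (B ^ DIM(real \<times> (real ^ 'd)) * W\<^sub>0 ^ r) \<le> D / 2"
    and c_small: "c * (B ^ DIM(real \<times> (real ^ 'd)) * W\<^sub>1 ^ r) \<le> D / 2"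
begin

definition "\<l> = (b - a) / 2"
definition "mid = a + \<l>"
definition "\<tau> = \<l> / N"
text \<open>Half the side of a spatial cell, so the cube of half-width \<open>h\<close> about
  \<open>\<eta> + v\<close> is exactly one cell.\<close>

definition "h = \<rho> / (2 * N)"
definition "A = c / real N ^ r"

text \<open>The first summand drives the solution: its single pulse has integral
  \<open>\<l>\<close>, whence the division by \<open>\<l>\<close> for a total shift
  \<open>v\<close>. The second carries the bumps, in coordinate \<open>j\<^sub>0\<close>
  only.\<close>

definition component :: "nat set \<Rightarrow> 'd \<Rightarrow> (real \<times> (real ^ 'd)) list \<Rightarrow> real \<times> (real ^ 'd) \<Rightarrow> real" where
  "component I k es p = (v $ k / \<l>) * tensor (tube (pulses {0} \<l> a) R \<eta>) es p
     + (if k = j\<^sub>0 then A else 0) * tensor (tube (pulses I \<tau> mid) h (\<eta> + v)) es p"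

definition field :: "nat set \<Rightarrow> real \<times> (real ^ 'd) \<Rightarrow> real ^ 'd" where
  "field I p = (\<chi> k. component I k [] p)"

text \<open>The integral of the field as if both spatial cut-offs equalled 1 along the
  trajectory.\<close>

definition solution :: "nat set \<Rightarrow> real \<Rightarrow> real ^ 'd" where
  "solution I t = \<eta> + steps {0} \<l> a t *\<^sub>R v + (A * \<tau> * steps I \<tau> mid t) *\<^sub>R axis j\<^sub>0 1"

lemma pos: "\<l> > 0" "\<tau> > 0" "h > 0" "A > 0"
  using ab N \<rho> c by (auto simp: \<l>_def \<tau>_def h_def A_def)

section \<open>Membership of the fields in the class\<close>

lemma component_family: "derivative_family r S (component I k)"
  unfolding component_def[abs_def]
  by (intro derivative_family_add derivative_family_cmult derivative_family_tensor tube_chain pulses_chain)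

lemma iterated_partial_field:
  assumes "set es \<subseteq> Basis" "length es \<le> r" "p \<in> strip a b"
  shows "iterated_partial (strip a b) es (\<lambda>q. field I q $ k) p = component I k es p"
  using iterated_partial_eq_family[OF component_family at_within_line_strip_ne_bot[OF ab] assms]
  by (simp add: field_def)

text \<open>Drive and bumps each get half of \<open>D\<close>.\<close>

lemma abs_component_le:
  assumes "finite I" and es: "set es \<subseteq> Basis" "length es \<le> r"
  shows "\<bar>component I k es p\<bar> \<le> D"
proof -
  let ?K = "B ^ DIM(real \<times> (real ^ 'd))"
  have B0: "B > 0" "?K > 0" using B_ge_1 by auto
  have bd: "\<bar>pulses J \<theta> s j t\<bar> \<le> B * W ^ j" if "finite J" "j \<le> r" "\<theta> > 0" "1 / \<theta> \<le> W" for J \<theta> s j t W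
  proof -
    have "B * (1/\<theta>) ^ j \<le> B * W ^ j" using that B0 by (intro mult_left_mono power_mono) auto
    then show ?thesis using abs_pulses_le[OF that(1-3), of s t] by linarith
  qed
  have N1: "real N \<ge> 1" using N by simp
  have "0 \<le> c * (?K * W\<^sub>1 ^ r)" using c W\<^sub>1 B0 by simp
  then have D: "D \<ge> 0" using c_small by linarith
  have "\<bar>tensor (tube (pulses {0} \<l> a) R \<eta>) es p\<bar> \<le> ?K * W\<^sub>0 ^ length es"
    using W\<^sub>0 R pos es by (intro abs_tensor_tube_le bd) (auto simp: \<l>_def)
  also have "\<dots> \<le> ?K * W\<^sub>0 ^ r"
    using W\<^sub>0 es B0 by (intro mult_left_mono power_increasing) auto
  finally have 1: "\<bar>tensor (tube (pulses {0} \<l> a) R \<eta>) es p\<bar> \<le> ?K * W\<^sub>0 ^ r" .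
  have 0: "0 \<le> v $ k" "v $ k \<le> \<rho>" using v[of k] pos(3) by (auto simp: h_def)
  have "\<bar>(v $ k / \<l>) * tensor (tube (pulses {0} \<l> a) R \<eta>) es p\<bar> \<le> (\<rho> / \<l>) * (?K * W\<^sub>0 ^ r)"
    unfolding abs_mult using 0 1 pos by (intro mult_mono) (auto simp: divide_right_mono)
  also have "\<dots> \<le> D / 2" using \<rho>_small by (simp add: \<l>_def)
  finally have 2: "\<bar>(v $ k / \<l>) * tensor (tube (pulses {0} \<l> a) R \<eta>) es p\<bar> \<le> D / 2" .
  \<comment> \<open>Refining the grid by \<open>N\<close> multiplies the rates
    \<open>1 / \<tau>\<close> and \<open>1 / h\<close> by \<open>N\<close>.\<close>
  have "real N * (1 / ((b - a) / 2)) \<le> real N * W\<^sub>1" "real N * (2 / \<rho>) \<le> real N * W\<^sub>1"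
    by (rule mult_left_mono[OF W\<^sub>1(2)], simp) (rule mult_left_mono[OF W\<^sub>1(3)], simp)
  then have "1 / \<tau> \<le> real N * W\<^sub>1" "1 / h \<le> real N * W\<^sub>1"
    by (simp_all add: \<tau>_def h_def \<l>_def mult.commute)
  then have "\<bar>tensor (tube (pulses I \<tau> mid) h (\<eta> + v)) es p\<bar> \<le> ?K * (real N * W\<^sub>1) ^ length es"
    using pos es assms(1) by (intro abs_tensor_tube_le bd) auto
  also have "\<dots> \<le> ?K * (real N * W\<^sub>1) ^ r"
  proof -
    have "1 * 1 \<le> real N * W\<^sub>1" using N1 W\<^sub>1 by (intro mult_mono) auto
    then show ?thesis using es B0 by (intro mult_left_mono power_increasing) auto
  qed
  finally have "A * \<bar>tensor (tube (pulses I \<tau> mid) h (\<eta> + v)) es p\<bar> \<le> A * (?K * (real N * W\<^sub>1) ^ r)"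
    using pos by (intro mult_left_mono) auto
  \<comment> \<open>The worst order \<open>r\<close> costs \<open>N ^ r\<close>, which the height
    \<open>A\<close> compensates exactly.\<close>
  also have "\<dots> = c * (?K * W\<^sub>1 ^ r)" using N1 by (simp add: A_def power_mult_distrib)
  also have "\<dots> \<le> D / 2" by (rule c_small)
  finally have 3: "\<bar>(if k = j\<^sub>0 then A else 0) * tensor (tube (pulses I \<tau> mid) h (\<eta> + v)) es p\<bar> \<le> D / 2"
    using pos by (cases "k = j\<^sub>0") (simp_all add: abs_mult D)
  show ?thesis unfolding component_def using 2 3 by linarith
qed

text \<open>The cell about \<open>\<eta> + v\<close> lies in the cube
  \<open>\<eta> + [0, \<rho>]^d\<close> with \<open>\<rho> \<le> R / 2\<close>, so both cut-offs
  vanish outside the box of half-width \<open>R\<close>, which is inside \<open>M\<close>.\<close>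

lemma component_eq_0_outside:
  assumes "y \<notin> M"
  shows "component I k [] (t, y) = 0"
proof -
  obtain l where l: "\<bar>y $ l - \<eta> $ l\<bar> \<ge> R" using box assms by (meson not_le)
  have "v $ l + h \<le> \<rho>" "0 \<le> v $ l" using v[of l] pos(3) by (auto simp: h_def)
  then have "\<bar>y $ l - (\<eta> + v) $ l\<bar> \<ge> h" using l \<rho> R by (simp add: abs_if split: if_splits)
  then show ?thesis
    using l R pos tensor_tube_eq_0_space[of R "[]" y l \<eta>] tensor_tube_eq_0_space[of h "[]" y l "\<eta> + v"]
    by (simp add: component_def)
qed

lemma field_in_F_non:
  assumes "finite I"
  shows "field I \<in> F_non r a b M D"
  unfolding F_non_def mem_Collect_eq
proof (intro conjI allI ballI impI)
  show "Cr_on r (strip a b) (\<lambda>p. field I p $ k)" for k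
    using Cr_on_family[OF component_family[of _ I k] at_within_line_strip_ne_bot[OF ab]]
    by (simp add: field_def)
  show "field I (t, y) = 0" if "y \<notin> M" for t y
    using component_eq_0_outside[OF that] by (simp add: field_def vec_eq_iff)
  show "\<bar>iterated_partial (strip a b) es (\<lambda>q. field I q $ k) p\<bar> \<le> D"
    if "set es \<subseteq> Basis \<and> length es \<le> r" "p \<in> strip a b" for es k p
    using that abs_component_le[OF assms] by (simp add: iterated_partial_field)
qed

lemma field_eq:
  "field I p = (tensor (tube (pulses {0} \<l> a) R \<eta>) [] p / \<l>) *\<^sub>R v
    + (A * tensor (tube (pulses I \<tau> mid) h (\<eta> + v)) [] p) *\<^sub>R axis j\<^sub>0 1"
  by (simp add: vec_eq_iff field_def component_def axis_def)

section \<open>Explicit solutions\<close>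

lemma mid_plus: "mid + \<l> = b" by (simp add: mid_def \<l>_def field_simps)

lemma ivp_solves_solution:
  assumes "I \<subseteq> {..<N}"
  shows "ivp_solves a b \<eta> (field I) (solution I)"
  unfolding ivp_solves_def
proof (intro conjI ballI)
  show "solution I a = \<eta>"
    using steps_eq_0[OF pos(1), of a a] steps_eq_0[OF pos(2), of a mid] pos(1)
    by (simp add: solution_def mid_def)
  fix t assume t: "t \<in> {a..b}"
  have fin: "finite I" "card I \<le> N"
    using assms finite_subset[OF assms] card_mono[OF _ assms] by auto
  have v0: "0 \<le> v $ k" "v $ k \<le> \<rho>" for k using v[of k] pos(3) by (auto simp: h_def)
  \<comment> \<open>Up to \<open>mid\<close> the trajectory stays within \<open>R / 2\<close> of
    \<open>\<eta>\<close>, on the plateau; afterwards the driving pulse is over.\<close>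
  have drive: "tensor (tube (pulses {0} \<l> a) R \<eta>) [] (t, solution I t) = pulses {0} \<l> a 0 t"
  proof (cases "t \<le> mid")
    case True
    have "\<bar>solution I t $ k - \<eta> $ k\<bar> \<le> R / 2" for k
    proof -
      have "solution I t $ k - \<eta> $ k = steps {0} \<l> a t * v $ k"
        using steps_eq_0[OF pos(2) True] by (simp add: solution_def)
      moreover have "steps {0} \<l> a t * v $ k \<le> 1 * \<rho>"
        using steps_range[of "{0}" \<l> a t] v0 by (intro mult_mono) auto
      moreover have "0 \<le> steps {0} \<l> a t * v $ k"
        using steps_range[of "{0}" \<l> a t] v0 by (intro mult_nonneg_nonneg) auto
      ultimately show ?thesis using \<rho> by simp
    qed
    then show ?thesis by (rule tensor_tube_eq_time[OF R])
  next
    case False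
    then have "pulses {0} \<l> a 0 t = 0" by (intro pulses_eq_0 pos) (auto simp: mid_def)
    then show ?thesis by (simp add: tensor_tube_Nil)
  qed
  \<comment> \<open>Up to \<open>mid\<close> no bump is active; afterwards the total displacement
    stays within \<open>h / 2\<close> of \<open>\<eta> + v\<close>.\<close>
  have bumps: "tensor (tube (pulses I \<tau> mid) h (\<eta> + v)) [] (t, solution I t) = pulses I \<tau> mid 0 t"
  proof (cases "t \<le> mid")
    case True
    have "pulses I \<tau> mid 0 t = 0"
    proof (rule pulses_eq_0[OF pos(2)])
      fix i :: nat
      have "0 \<le> real i * \<tau>" using pos by simp
      then show "\<not> (mid + real i * \<tau> < t \<and> t < mid + (real i + 1) * \<tau>)" using True by linarith
    qed simp
    then show ?thesis by (simp add: tensor_tube_Nil)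
  next
    case False
    have one: "steps {0} \<l> a t = 1"
      using False steps_eq_card[OF pos(1), of "{0}" a t] by (simp add: mid_def)
    have "\<bar>solution I t $ k - (\<eta> + v) $ k\<bar> \<le> h / 2" for k
    proof -
      have "\<bar>solution I t $ k - (\<eta> + v) $ k\<bar> \<le> A * \<tau> * steps I \<tau> mid t"
        using one pos steps_range by (simp add: solution_def axis_def)
      also have "\<dots> \<le> A * \<tau> * real N"
        using pos fin steps_range(2)[of I \<tau> mid t] by (intro mult_left_mono) auto
      also have "\<dots> = A * \<l>" using N by (simp add: \<tau>_def)
      \<comment> \<open>Here \<open>r \<ge> 1\<close> enters: the bumps are low enough that even all
        \<open>N\<close> of them displace by at most \<open>c * \<l> / N\<close>, of the order of a
        cell.\<close>
      also have "\<dots> \<le> (c / real N) * \<l>"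
      proof -
        have "real N ^ 1 \<le> real N ^ r" using r N by (intro power_increasing) auto
        then have "A \<le> c / real N" unfolding A_def using c N by (intro divide_left_mono) auto
        then show ?thesis using pos by (intro mult_right_mono) auto
      qed
      also have "\<dots> = (c * \<l>) / real N" by simp
      also have "\<dots> \<le> (\<rho> / 4) / real N" using c by (intro divide_right_mono) (auto simp: \<l>_def)
      also have "\<dots> = h / 2" by (simp add: h_def)
      finally show ?thesis .
    qed
    then show ?thesis by (rule tensor_tube_eq_time[OF pos(3)])
  qed
  have "(solution I has_vector_derivative 0 + (pulses {0} \<l> a 0 t / \<l>) *\<^sub>R v
      + (A * \<tau> * (pulses I \<tau> mid 0 t / \<tau>)) *\<^sub>R axis j\<^sub>0 1) (at t within {a..b})"
  proof -
    have scale: "((\<lambda>t. g t *\<^sub>R u) has_vector_derivative g' *\<^sub>R u) (at t within {a..b})"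
      if "(g has_real_derivative g') (at t within {a..b})" for g g' and u :: "real ^ 'd"
      using has_vector_derivative_scaleR[OF that has_vector_derivative_const, of u] by simp
    show ?thesis unfolding solution_def[abs_def]
      by (intro has_vector_derivative_add has_vector_derivative_const scale DERIV_cmult has_derivative_steps)
  qed
  then show "(solution I has_vector_derivative field I (t, solution I t)) (at t within {a..b})"
    using pos by (simp add: field_eq drive bumps)
qed

text \<open>Needed for uniqueness only, so \<open>L\<close> may depend on \<open>N\<close> and
  \<open>I\<close>.\<close>

lemma field_lipschitz:
  assumes "finite I"
  shows "\<exists>L. \<forall>t x y. norm (field I (t, x) - field I (t, y)) \<le> L * norm (x - y)"
proof -
  let ?F = "tensor (tube (pulses {0} \<l> a) R \<eta>) []" and ?G = "tensor (tube (pulses I \<tau> mid) h (\<eta> + v)) []"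
  have p: "\<bar>pulses {0} \<l> a 0 t\<bar> \<le> B" "\<bar>pulses I \<tau> mid 0 t\<bar> \<le> B" for t
    using abs_pulses_le[of "{0}" 0 \<l> a t] abs_pulses_le[of I 0 \<tau> mid t] pos assms by auto
  let ?L = "B * (real CARD('d) * (B / R)) / \<l> * norm v + A * (B * (real CARD('d) * (B / h)))"
  show ?thesis
  proof (rule exI[of _ ?L], intro allI)
    fix t x y
    have diff: "field I (t, x) - field I (t, y) = ((?F (t, x) - ?F (t, y)) / \<l>) *\<^sub>R v
       + (A * (?G (t, x) - ?G (t, y))) *\<^sub>R axis j\<^sub>0 1"
      by (simp add: field_eq algebra_simps diff_divide_distrib)
    have "norm (field I (t, x) - field I (t, y)) \<le> \<bar>?F (t, x) - ?F (t, y)\<bar> / \<l> * norm v + A * \<bar>?G (t, x) - ?G (t, y)\<bar>"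
      unfolding diff using pos by (intro norm_triangle_le) (simp add: abs_mult)
    also have "\<dots> \<le> (B * (real CARD('d) * (B / R)) * norm (x - y)) / \<l> * norm v
        + A * (B * (real CARD('d) * (B / h)) * norm (x - y))"
    proof (rule add_mono)
      have "\<bar>?F (t, x) - ?F (t, y)\<bar> \<le> B * (real CARD('d) * (B / R)) * norm (x - y)"
        by (rule tensor_tube_lipschitz[where T = "pulses {0} \<l> a", OF p(1) R])
      then show "\<bar>?F (t, x) - ?F (t, y)\<bar> / \<l> * norm v \<le> (B * (real CARD('d) * (B / R)) * norm (x - y)) / \<l> * norm v"
        using pos by (intro mult_right_mono divide_right_mono) auto
      have "\<bar>?G (t, x) - ?G (t, y)\<bar> \<le> B * (real CARD('d) * (B / h)) * norm (x - y)"
        by (rule tensor_tube_lipschitz[where T = "pulses I \<tau> mid", OF p(2) pos(3)])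
      then show "A * \<bar>?G (t, x) - ?G (t, y)\<bar> \<le> A * (B * (real CARD('d) * (B / h)) * norm (x - y))"
        using pos by (intro mult_left_mono) auto
    qed
    also have "\<dots> = ?L * norm (x - y)" by (simp add: algebra_simps)
    finally show "norm (field I (t, x) - field I (t, y)) \<le> ?L * norm (x - y)" .
  qed
qed

lemma ivp_solution_field:
  assumes "I \<subseteq> {..<N}" "t \<in> {a..b}"
  shows "ivp_solution a b \<eta> (field I) t = solution I t"
proof -
  have sol: "ivp_solves a b \<eta> (field I) (solution I)" by (rule ivp_solves_solution[OF assms(1)])
  then have sol': "ivp_solves a b \<eta> (field I) (ivp_solution a b \<eta> (field I))"
    unfolding ivp_solution_def by (rule someI[of "ivp_solves a b \<eta> (field I)"])
  obtain L where "\<And>t x y. norm (field I (t, x) - field I (t, y)) \<le> L * norm (x - y)"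
    using field_lipschitz[of I] finite_subset[OF assms(1)] by auto
  then show ?thesis using sol' sol assms(2) by (rule ivp_solution_unique)
qed

text \<open>The drive cancels in the difference, and by time \<open>b\<close> each pulse has
  contributed its full \<open>A * \<tau>\<close>, always with the same sign.\<close>

lemma solution_endpoint:
  assumes "I \<subseteq> {..<N}"
  shows "solution I b $ j\<^sub>0 - solution {} b $ j\<^sub>0 = A * \<tau> * real (card I)"
proof -
  have "steps I \<tau> mid b = real (card I)"
  proof (rule steps_eq_card[OF pos(2)])
    fix i assume "i \<in> I"
    then have "real i + 1 \<le> real N" using assms by auto
    then have "(real i + 1) * \<tau> \<le> real N * \<tau>" using pos by (intro mult_right_mono) auto
    then show "mid + (real i + 1) * \<tau> \<le> b" using mid_plus N by (simp add: \<tau>_def)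
  qed
  then show ?thesis by (simp add: solution_def steps_def)
qed

section \<open>Indistinguishable fields and the resulting error\<close>

lemma eval_field_eq:
  assumes "standard_functional r a b (es, k, t, y)"
    and "\<And>i. i \<in> I \<Longrightarrow> \<not> (mid + real i * \<tau> < t \<and> t < mid + (real i + 1) * \<tau> \<and> (\<forall>l. \<bar>y $ l - (\<eta> + v) $ l\<bar> < h))"
  shows "eval_functional a b (field I) (es, k, t, y) = eval_functional a b (field {}) (es, k, t, y)"
proof -
  have es: "set es \<subseteq> Basis" "length es \<le> r" "(t, y) \<in> strip a b"
    using assms(1) by (auto simp: standard_functional_def)
  have c: "count_list es (1, 0) \<le> r" using es count_list_le_length[of es "(1, 0)"] by linarith
  \<comment> \<open>Every derivative up to order \<open>r\<close> vanishes off the open cells: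
    either the time factor or a spatial factor is 0. Sample points on cell boundaries are therefore
    harmless.\<close>
  have "tensor (tube (pulses I \<tau> mid) h (\<eta> + v)) es (t, y) = 0"
  proof (cases "\<forall>l. \<bar>y $ l - (\<eta> + v) $ l\<bar> < h")
    case True
    then have "pulses I \<tau> mid (count_list es (1, 0)) t = 0"
      using assms(2) c by (intro pulses_eq_0 pos) auto
    then show ?thesis by (simp add: tensor_tube)
  next
    case False
    then show ?thesis using tensor_tube_eq_0_space es pos by (meson not_le)
  qed
  moreover have "tensor (tube (pulses {} \<tau> mid) h (\<eta> + v)) es (t, y) = 0"
    by (simp add: tensor_tube pulses_def)
  ultimately show ?thesis
    by (simp add: eval_functional_def iterated_partial_field[OF es] component_def)
qed

text \<open>Equal information forces one and the same output for both fields, and this output lies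
  within \<open>\<epsilon>\<close> of both endpoints.\<close>

lemma error_lower_bound:
  assumes "I \<subseteq> {..<N}" and F: "\<forall>L\<in>set F. standard_functional r a b L"
    and I: "\<And>es k t y i. (es, k, t, y) \<in> set F \<Longrightarrow> i \<in> I \<Longrightarrow>
      \<not> (mid + real i * \<tau> < t \<and> t < mid + (real i + 1) * \<tau> \<and> (\<forall>l. \<bar>y $ l - (\<eta> + v) $ l\<bar> < h))"
    and err: "worst_case_error r a b M D \<eta> \<Phi> F \<le> ereal \<epsilon>"
  shows "A * \<tau> * real (card I) \<le> 2 * \<epsilon>"
proof -
  have same: "information a b F (field I) = information a b F (field {})"
    unfolding information_def using F I by (force intro: eval_field_eq)
  have bI: "\<bar>solution J b $ j\<^sub>0 - \<Phi> (information a b F (field J)) b $ j\<^sub>0\<bar> \<le> \<epsilon>" if "J \<subseteq> {..<N}" for J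
  proof -
    have b: "b \<in> {a..b}" using ab by simp
    have "ereal (infnorm (ivp_solution a b \<eta> (field J) b - \<Phi> (information a b F (field J)) b))
       \<le> worst_case_error r a b M D \<eta> \<Phi> F"
      unfolding worst_case_error_def
      by (rule SUP_upper2[OF field_in_F_non[of J] SUP_upper[OF b]]) (use that finite_subset in auto)
    then have "infnorm (solution J b - \<Phi> (information a b F (field J)) b) \<le> \<epsilon>"
      using err ivp_solution_field[OF that b] by (metis ereal_less_eq(3) order_trans)
    moreover have "\<bar>(solution J b - \<Phi> (information a b F (field J)) b) $ j\<^sub>0\<bar>
       \<le> infnorm (solution J b - \<Phi> (information a b F (field J)) b)"
      by (rule component_le_infnorm_cart)
    ultimately show ?thesis by simp
  qed
  from bI[OF assms(1)] bI[of "{}"] same solution_endpoint[OF assms(1)] show ?thesis by simp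
qed

end

section \<open>Choosing an undersampled column\<close>

text \<open>Averaging: if every column had more than \<open>N / 2\<close> hits, their sum would
  exceed \<open>card H\<close>.\<close>

lemma exists_sparse_fibre:
  fixes H :: "('a \<times> nat) set"
  assumes "finite Q" "Q \<noteq> {}" "finite H" "2 * card H \<le> card Q * N"
  shows "\<exists>q\<in>Q. 2 * card {i\<in>{..<N}. (q, i) \<in> H} \<le> N"
proof (rule ccontr)
  assume "\<not> ?thesis"
  then have "(\<Sum>q\<in>Q. N) < (\<Sum>q\<in>Q. 2 * card {i\<in>{..<N}. (q, i) \<in> H})"
    using assms by (intro sum_strict_mono) auto
  also have "\<dots> = 2 * card (SIGMA q:Q. {i\<in>{..<N}. (q, i) \<in> H})"
    using assms(1) by (simp add: sum_distrib_left)
  also have "\<dots> \<le> 2 * card H"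
    using assms(3) by (intro mult_left_mono card_mono) auto
  finally show False using assms(4) by simp
qed

lemma nat_floor_eq_cell:
  fixes y :: real
  assumes "h > 0" "\<bar>y - (2 * real q + 1) * h\<bar> < h"
  shows "nat \<lfloor>y / (2 * h)\<rfloor> = q"
proof -
  have "\<lfloor>y / (2 * h)\<rfloor> = int q"
    using assms by (intro floor_unique) (auto simp: field_simps abs_less_iff)
  then show ?thesis by simp
qed

text \<open>All constants are fixed before \<open>N\<close>, \<open>F\<close> and
  \<open>\<epsilon>\<close>, in the order \<open>R\<close>, \<open>W\<^sub>0\<close>,
  \<open>\<rho>\<close>, \<open>W\<^sub>1\<close>, \<open>c\<close>, each depending on earlier
  ones.\<close>

lemma (in cutoffs) error_vs_cardinality:
  fixes M :: "(real ^ 'd) set" and \<eta> :: "real ^ 'd"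
  assumes "a < b" "D > 0" "open M" "\<eta> \<in> M"
  shows "\<exists>\<kappa>>0. \<forall>N F \<Phi> \<epsilon>. N \<ge> 1 \<longrightarrow> (\<forall>L\<in>set F. standard_functional r a b L) \<longrightarrow>
    2 * length F \<le> N ^ (CARD('d) + 1) \<longrightarrow> worst_case_error r a b M D \<eta> \<Phi> F \<le> ereal \<epsilon> \<longrightarrow>
    \<kappa> / real N ^ r \<le> \<epsilon>"
proof -
  define \<l> where "\<l> = (b - a) / 2"
  have l: "\<l> > 0" using assms by (simp add: \<l>_def)
  let ?K = "B ^ DIM(real \<times> (real ^ 'd))"
  have K: "?K > 0" using B_ge_1 by auto
  obtain R0 where R0: "R0 > 0" "ball \<eta> R0 \<subseteq> M" using assms(3,4) open_contains_ball by blast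
  \<comment> \<open>Dividing by the dimension makes the box of half-width \<open>R\<close> fit into
    the Euclidean ball, since the Euclidean norm is at most the sum of the coordinates' absolute
    values.\<close>
  define R where "R = R0 / real CARD('d)"
  have R: "R > 0" using R0 by (simp add: R_def)
  have box: "y \<in> M" if "\<And>k. \<bar>y $ k - \<eta> $ k\<bar> < R" for y
  proof -
    have "norm (y - \<eta>) \<le> (\<Sum>k\<in>UNIV. \<bar>(y - \<eta>) $ k\<bar>)" by (rule norm_le_l1_cart)
    also have "\<dots> < (\<Sum>k\<in>(UNIV::'d set). R)" using that by (intro sum_strict_mono) auto
    also have "\<dots> = R0" by (simp add: R_def)
    finally show ?thesis using R0 by (auto simp: dist_norm norm_minus_commute)
  qed
  define W\<^sub>0 where "W\<^sub>0 = max 1 (max (1 / \<l>) (1 / R))"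
  define \<rho> where "\<rho> = min (R / 2) (D / 2 * \<l> / (?K * W\<^sub>0 ^ r))"
  have W0: "W\<^sub>0 \<ge> 1" "1 / \<l> \<le> W\<^sub>0" "1 / R \<le> W\<^sub>0" by (auto simp: W\<^sub>0_def)
  then have KW0: "?K * W\<^sub>0 ^ r > 0" using K by auto
  have \<rho>: "\<rho> > 0" "\<rho> \<le> R / 2" "\<rho> / \<l> * (?K * W\<^sub>0 ^ r) \<le> D / 2"
  proof -
    show "\<rho> > 0" "\<rho> \<le> R / 2" using R l KW0 assms(2) by (auto simp: \<rho>_def)
    have "\<rho> \<le> D / 2 * \<l> / (?K * W\<^sub>0 ^ r)" by (simp add: \<rho>_def)
    then show "\<rho> / \<l> * (?K * W\<^sub>0 ^ r) \<le> D / 2"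
      using l KW0 by (simp only: pos_le_divide_eq) (simp add: field_simps)
  qed
  define W\<^sub>1 where "W\<^sub>1 = max 1 (max (1 / \<l>) (2 / \<rho>))"
  define c where "c = min (\<rho> / 4 / \<l>) (D / 2 / (?K * W\<^sub>1 ^ r))"
  have W1: "W\<^sub>1 \<ge> 1" "1 / \<l> \<le> W\<^sub>1" "2 / \<rho> \<le> W\<^sub>1" by (auto simp: W\<^sub>1_def)
  then have KW1: "?K * W\<^sub>1 ^ r > 0" using K by auto
  have c: "c > 0" "c * \<l> \<le> \<rho> / 4" "c * (?K * W\<^sub>1 ^ r) \<le> D / 2"
  proof -
    show "c > 0" using \<rho> l KW1 assms(2) by (auto simp: c_def)
    have "c \<le> \<rho> / 4 / \<l>" "c \<le> D / 2 / (?K * W\<^sub>1 ^ r)" by (auto simp: c_def)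
    then show "c * \<l> \<le> \<rho> / 4" "c * (?K * W\<^sub>1 ^ r) \<le> D / 2"
      using l KW1 by (simp_all only: pos_le_divide_eq)
  qed
  show ?thesis
  \<comment> \<open>With at least \<open>N / 2\<close> bumps, \<open>2 * \<epsilon>\<close> is at
    least \<open>(c / N ^ r) * (\<l> / N) * (N / 2)\<close>, which gives the factor 1/4.\<close>
  proof (intro exI[of _ "c * \<l> / 4"] conjI allI impI)
    show "c * \<l> / 4 > 0" using c l by simp
    fix N :: nat and F :: "'d functional list" and \<Phi> \<epsilon>
    assume N: "N \<ge> 1" and F: "\<forall>L\<in>set F. standard_functional r a b L"
      and card: "2 * length F \<le> N ^ (CARD('d) + 1)"
      and err: "worst_case_error r a b M D \<eta> \<Phi> F \<le> ereal \<epsilon>"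
    define h where "h = \<rho> / (2 * N)"
    define \<tau> where "\<tau> = \<l> / N"
    have h: "h > 0" "\<tau> > 0" using \<rho> N l by (auto simp: h_def \<tau>_def)
    define Q :: "('d \<Rightarrow> nat) set" where "Q = PiE UNIV (\<lambda>_. {..<N})"
    \<comment> \<open>The index of the cell containing the sample point. \<open>nat\<close> sends
      negative indices to 0, which can only mark an empty cell as hit; there are still at most
      \<open>length F\<close> hits.\<close>
    define cell :: "'d functional \<Rightarrow> ('d \<Rightarrow> nat) \<times> nat" where
      "cell = (\<lambda>(es, k, t, y). (\<lambda>l. nat \<lfloor>(y $ l - \<eta> $ l) / (2 * h)\<rfloor>, nat \<lfloor>(t - (a + \<l>)) / \<tau>\<rfloor>))"
    have Q: "finite Q" "card Q = N ^ CARD('d)" by (auto simp: Q_def card_PiE intro!: finite_PiE)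
    moreover have "card Q > 0" using Q N by simp
    then have "Q \<noteq> {}" by auto
    moreover have "card (cell ` set F) \<le> length F"
      by (meson card_image_le card_length finite_set le_trans)
    then have "2 * card (cell ` set F) \<le> card Q * N" using card Q by (simp add: mult.commute)
    ultimately obtain q where q: "q \<in> Q" "2 * card {i\<in>{..<N}. (q, i) \<in> cell ` set F} \<le> N"
      using exists_sparse_fibre[of Q "cell ` set F" N] by auto
    define I where "I = {..<N} - {i\<in>{..<N}. (q, i) \<in> cell ` set F}"
    \<comment> \<open>The centre of the spatial cell \<open>q\<close>, relative to
      \<open>\<eta>\<close>.\<close>
    define v :: "real ^ 'd" where "v = (\<chi> k. (2 * real (q k) + 1) * h)"
    have v: "h \<le> v $ k" "v $ k \<le> \<rho> - h" for k
    proof -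
      have "q k < N" using q(1) by (auto simp: Q_def)
      then have "real (q k) + 1 \<le> real N" by simp
      then have "(2 * real (q k) + 2) * h \<le> (2 * real N) * h" using h by (intro mult_right_mono) auto
      also have "\<dots> = \<rho>" using N by (simp add: h_def)
      finally show "v $ k \<le> \<rho> - h" by (simp add: v_def algebra_simps)
      have "1 * h \<le> (2 * real (q k) + 1) * h" using h by (intro mult_right_mono) auto
      then show "h \<le> v $ k" by (simp add: v_def)
    qed
    \<comment> \<open>The argument works for every coordinate \<open>j\<^sub>0\<close>, so
      \<open>undefined\<close> serves.\<close>
    interpret P: fooling r \<sigma> \<phi> B a b D M \<eta> v undefined R \<rho> c W\<^sub>0 W\<^sub>1 N
      by unfold_locales
        (use assms R box \<rho> N c v[unfolded h_def] W0 W1 in \<open>auto simp: \<l>_def[symmetric]\<close>)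
    have eqs: "P.\<tau> = \<tau>" "P.h = h" "P.mid = a + \<l>"
      by (simp_all add: P.\<tau>_def P.h_def P.mid_def P.\<l>_def \<tau>_def h_def \<l>_def)
    have "P.A * P.\<tau> * real (card I) \<le> 2 * \<epsilon>"
    proof (rule P.error_lower_bound[OF _ F _ err])
      show "I \<subseteq> {..<N}" by (auto simp: I_def)
      fix es k t y i
      assume L: "(es, k, t, y) \<in> set F" and i: "i \<in> I"
      show "\<not> (P.mid + real i * P.\<tau> < t \<and> t < P.mid + (real i + 1) * P.\<tau> \<and> (\<forall>l. \<bar>y $ l - (\<eta> + v) $ l\<bar> < P.h))"
        unfolding eqs
      proof
        assume *: "a + \<l> + real i * \<tau> < t \<and> t < a + \<l> + (real i + 1) * \<tau> \<and> (\<forall>l. \<bar>y $ l - (\<eta> + v) $ l\<bar> < h)"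
        have "\<lfloor>(t - (a + \<l>)) / \<tau>\<rfloor> = int i"
          using * h by (intro floor_unique) (auto simp: field_simps)
        moreover have "nat \<lfloor>(y $ l - \<eta> $ l) / (2 * h)\<rfloor> = q l" for l
        proof (rule nat_floor_eq_cell[OF h(1)])
          have "\<bar>y $ l - (\<eta> + v) $ l\<bar> < h" using * by blast
          then show "\<bar>y $ l - \<eta> $ l - (2 * real (q l) + 1) * h\<bar> < h"
            by (simp add: v_def algebra_simps)
        qed
        ultimately have "cell (es, k, t, y) = (q, i)" by (simp add: cell_def)
        then have "(q, i) \<in> cell ` set F" using L by (metis image_eqI)
        then show False using i by (auto simp: I_def)
      qed
    qed
    moreover have "real N / 2 \<le> real (card I)"
    proof -
      have "card I = N - card {i\<in>{..<N}. (q, i) \<in> cell ` set F}"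
        unfolding I_def by (subst card_Diff_subset) auto
      then have "N \<le> 2 * card I" using q(2) by linarith
      then show ?thesis by linarith
    qed
    then have "P.A * P.\<tau> * (real N / 2) \<le> P.A * P.\<tau> * real (card I)"
      using P.pos by (intro mult_left_mono) auto
    moreover have "P.A * P.\<tau> * (real N / 2) = 2 * (c * \<l> / 4 / real N ^ r)"
      using N by (simp add: P.A_def eqs \<tau>_def mult.commute)
    ultimately show "c * \<l> / 4 / real N ^ r \<le> \<epsilon>" by linarith
  qed
qed

lemma ex_cutoffs:
  assumes "r \<ge> 1"
  shows "\<exists>\<sigma> \<phi> B. cutoffs r \<sigma> \<phi> B"
proof -
  obtain \<sigma> where \<sigma>: "deriv_chain (Suc r) \<sigma>" "\<forall>j\<le>Suc r. \<forall>x\<le>0. \<sigma> j x = 0" "\<forall>x\<ge>1. \<sigma> 0 x = 1"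
     "\<forall>j\<le>Suc r. \<forall>x\<ge>1. j \<noteq> 0 \<longrightarrow> \<sigma> j x = 0" "\<forall>x. 0 \<le> \<sigma> 0 x \<and> \<sigma> 0 x \<le> 1"
    using ex_smooth_step[of "Suc r"] by blast
  obtain \<phi> where \<phi>: "deriv_chain r \<phi>" "\<forall>j\<le>r. \<forall>x. \<bar>x\<bar> \<ge> 1 \<longrightarrow> \<phi> j x = 0"
     "\<forall>x. \<bar>x\<bar> \<le> 1/2 \<longrightarrow> \<phi> 0 x = 1" "\<forall>x. 0 \<le> \<phi> 0 x \<and> \<phi> 0 x \<le> 1"
    using ex_smooth_plateau[of r] by blast
  have "\<bar>\<sigma> j x\<bar> \<le> 1" if "j \<le> Suc r" "\<bar>x\<bar> \<ge> 1" for j x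
  proof (cases "x \<ge> 1")
    case True
    then show ?thesis using \<sigma>(3,4) that by (cases "j = 0") auto
  next
    case False
    then have "x \<le> 0" using that by linarith
    then show ?thesis using \<sigma>(2) that by simp
  qed
  then obtain B1 where B1: "B1 \<ge> 1" "\<forall>j\<le>Suc r. \<forall>x. \<bar>\<sigma> j x\<bar> \<le> B1"
    using deriv_chain_bounded[OF \<sigma>(1)] by blast
  obtain B2 where B2: "B2 \<ge> 1" "\<forall>j\<le>r. \<forall>x. \<bar>\<phi> j x\<bar> \<le> B2"
    using deriv_chain_bounded[OF \<phi>(1)] \<phi>(2) by force
  have "cutoffs r \<sigma> \<phi> (max B1 B2)"
    by unfold_locales (use assms \<sigma> \<phi> B1 B2 in \<open>auto simp: le_max_iff_disj\<close>)
  then show ?thesis by blast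
qed

section \<open>The lower bound\<close>

theorem mainTheorem3:
  fixes r :: nat and a b D :: real and M :: "(real ^ 'd) set" and \<eta> :: "real ^ 'd"
  assumes "r \<ge> 1" and "a < b" and "D > 0"
    and "open M" and "M \<noteq> {}" and "\<eta> \<in> M"
  shows "\<exists>C>0. \<exists>\<epsilon>\<^sub>0>0. \<forall>\<epsilon>. 0 < \<epsilon> \<and> \<epsilon> \<le> \<epsilon>\<^sub>0 \<longrightarrow>
    ereal_of_enat (comp_nonad r a b M D \<eta> \<epsilon>)
      \<ge> ereal (C * (1 / \<epsilon>) powr (real (CARD('d) + 1) / real r))"
proof -
  obtain \<sigma> \<phi> B where "cutoffs r \<sigma> \<phi> B" using ex_cutoffs[OF assms(1)] by blast
  then obtain \<kappa> where \<kappa>: "\<kappa> > 0" "\<And>N F \<Phi> \<epsilon>. N \<ge> 1 \<Longrightarrow> \<forall>L\<in>set F. standard_functional r a b L \<Longrightarrow>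
    2 * length F \<le> N ^ (CARD('d) + 1) \<Longrightarrow> worst_case_error r a b M D \<eta> \<Phi> F \<le> ereal \<epsilon> \<Longrightarrow>
    \<kappa> / real N ^ r \<le> \<epsilon>"
    using cutoffs.error_vs_cardinality[OF _ assms(2,3,4,6)] by metis
  let ?m = "CARD('d) + 1"
  \<comment> \<open>The real number with \<open>\<kappa> / X ^ r = 2 * \<epsilon>\<close>; the
    factor 2 leaves room for a strict contradiction. The threshold
    \<open>\<epsilon> \<le> \<kappa> / 2\<close> makes it at least 1.\<close>
  define X where "X = (\<lambda>\<epsilon>. (\<kappa> / (2 * \<epsilon>)) powr (1 / real r))"
  define C where "C = (((\<kappa> / 2) powr (1 / real r)) / 2) ^ ?m / 2"
  have "C > 0" using \<kappa>(1) by (simp add: C_def)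
  moreover have "\<forall>\<epsilon>. 0 < \<epsilon> \<and> \<epsilon> \<le> \<kappa> / 2 \<longrightarrow> ereal_of_enat (comp_nonad r a b M D \<eta> \<epsilon>)
      \<ge> ereal (C * (1 / \<epsilon>) powr (real (CARD('d) + 1) / real r))"
  proof (intro allI impI)
    fix \<epsilon> assume "0 < \<epsilon> \<and> \<epsilon> \<le> \<kappa> / 2"
    then have \<epsilon>: "\<epsilon> > 0" "\<epsilon> \<le> \<kappa> / 2" by auto
    have X1: "X \<epsilon> \<ge> 1" unfolding X_def using \<epsilon> by (intro ge_one_powr_ge_zero) (auto simp: field_simps)
    have Xr: "X \<epsilon> ^ r = \<kappa> / (2 * \<epsilon>)"
      using \<epsilon> \<kappa>(1) assms(1) by (simp add: X_def powr_realpow[symmetric] powr_powr)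
    define N where "N = nat \<lfloor>X \<epsilon>\<rfloor>"
    have "real N = of_int \<lfloor>X \<epsilon>\<rfloor>" "\<lfloor>X \<epsilon>\<rfloor> \<ge> 1" using X1 by (auto simp: N_def)
    \<comment> \<open>Rounding a number that is at least 1 down loses at most half of it; hence the
      \<open>/ 2\<close> inside the power in \<open>C\<close>.\<close>
    then have N: "N \<ge> 1" "real N \<le> X \<epsilon>" "X \<epsilon> / 2 \<le> real N" by linarith+
    have lower: "C * (1 / \<epsilon>) powr (real ?m / real r) = (X \<epsilon> / 2) ^ ?m / 2"
    proof -
      have "X \<epsilon> = (\<kappa> / 2) powr (1 / real r) * (1 / \<epsilon>) powr (1 / real r)"
        using \<epsilon> \<kappa>(1) by (simp add: X_def powr_mult[symmetric])
      moreover have "((1 / \<epsilon>) powr (1 / real r)) ^ ?m = (1 / \<epsilon>) powr (real ?m / real r)"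
        using \<epsilon> by (simp add: powr_realpow[symmetric] powr_powr del: power_Suc)
      ultimately show ?thesis by (simp add: C_def power_mult_distrib power_divide del: power_Suc)
    qed
    have bound: "C * (1 / \<epsilon>) powr (real ?m / real r) \<le> real (length F)"
      if F: "\<forall>L\<in>set F. standard_functional r a b L" "worst_case_error r a b M D \<eta> \<Phi> F \<le> ereal \<epsilon>" for F \<Phi>
    proof (rule ccontr)
      assume "\<not> ?thesis"
      then have "2 * real (length F) \<le> (X \<epsilon> / 2) ^ ?m" unfolding lower by simp
      also have "\<dots> \<le> real N ^ ?m" using N X1 by (intro power_mono) auto
      finally have "real (2 * length F) \<le> real (N ^ ?m)" by simp
      then have "2 * length F \<le> N ^ ?m" by (simp only: of_nat_le_iff)
      \<comment> \<open>Too little information gives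
        \<open>\<kappa> / N ^ r \<le> \<epsilon>\<close>, whereas \<open>N \<le> X\<close> gives at
        least \<open>2 * \<epsilon>\<close>.\<close>
      then have "\<kappa> / real N ^ r \<le> \<epsilon>" using \<kappa>(2)[OF N(1) F(1) _ F(2)] by simp
      moreover have "real N ^ r \<le> \<kappa> / (2 * \<epsilon>)" using N Xr by (metis of_nat_0_le_iff power_mono)
      moreover have "real N ^ r > 0" using N by simp
      ultimately have "\<kappa> \<le> \<epsilon> * (\<kappa> / (2 * \<epsilon>))"
        using \<epsilon> by (simp only: pos_divide_le_eq) (meson mult_left_mono less_imp_le order_trans)
      then show False using \<epsilon> \<kappa>(1) by simp
    qed
    show "ereal (C * (1 / \<epsilon>) powr (real ?m / real r)) \<le> ereal_of_enat (comp_nonad r a b M D \<eta> \<epsilon>)"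
    \<comment> \<open>A finite complexity is attained by some information of that length, to which
      \<open>bound\<close> applies; the infinite case is trivial.\<close>
    proof (cases "comp_nonad r a b M D \<eta> \<epsilon>")
      case (enat n)
      let ?S = "{enat n | n. n \<ge> 1 \<and> (\<exists>N \<Phi>. length N = n \<and> (\<forall>L\<in>set N. standard_functional r a b L) \<and>
        worst_case_error r a b M D \<eta> \<Phi> N \<le> ereal \<epsilon>)}"
      have "Inf ?S = enat n" using enat unfolding comp_nonad_def .
      then have "?S \<noteq> {}" by (metis Inf_enat_def enat.distinct(1))
      then have "Inf ?S \<in> ?S" by (meson ex_in_conv wellorder_InfI)
      then obtain F \<Phi> where "length F = n" "\<forall>L\<in>set F. standard_functional r a b L"
          "worst_case_error r a b M D \<eta> \<Phi> F \<le> ereal \<epsilon>"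
        using \<open>Inf ?S = enat n\<close> by auto
      then show ?thesis using bound enat by auto
    qed simp
  qed
  ultimately show ?thesis using half_gt_zero[OF \<kappa>(1)] by blast
qed

end
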